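(* For any commutative ring $B$ and positive integers $n$ and $r$, the natural maps $$B\mathrm{Sym}(n)\to\mathrm{End}_{P_r(n)}(V_B^{\otimes r})\quad\text{and}\quad B\mathrm{Sym}(n-1)\to\mathrm{End}_{P_{r+1/2}(n)}(V_B^{\otimes r})$$ given by the actions on $V_B^{\otimes r}$ are surjective.
   Context: $V_B$ is a free $B$-module with basis $v_1,\dots,v_n$; $V_B^{\otimes r}$ is its $r$-fold tensor power over $B$, with basis $v_i=v_{i_1}\otimes\dots\otimes v_{i_r}$ for $i=(i_1,\dots,i_r)\in\{1,\dots,n\}^r$. $\mathrm{Sym}(n)$ permutes the basis of $V_B$ and acts diagonally on $V_B^{\otimes r}$; $\mathrm{Sym}(n-1)$ is the subgroup fixing $n$. For $\delta\in B$ the partition algebra $P_r(\delta)=P_r(\delta)_B$ is the $B$-algebra with $B$-basis the set partitions of $\{1,\dots,r,1',\dots,r'\}$; the product $d_1d_2$ is obtained by placing $d_1$ above $d_2$, identifying the bottom (primed) vertices of $d_1$ with the top vertices of $d_2$, taking connected components restricted to the top and bottom rows, and multiplying by $\delta^c$, where $c$ is the number of components lying entirely in the middle row. The half partition algebra $P_{r+1/2}(\delta)$ is the subalgebra of $P_{r+1}(\delta)$ spanned by set partitions in which $r+1$ and $(r+1)'$ lie in the same block. $P_r(n)$ ($\delta=n\cdot 1_B$) acts on $V_B^{\otimes r}$ by $d\,v_{i_{1'}}\otimes\dots\otimes v_{i_{r'}}=\sum v_{i_1}\otimes\dots\otimes v_{i_r}$, the sum over all $(i_1,\dots,i_r)\in\{1,\dots,n\}^r$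 such that $x\mapsto i_x$ is constant on every block of $d$. $P_{r+1/2}(n)\subseteq P_{r+1}(n)$ preserves $V_B^{\otimes r}\otimes v_n\subseteq V_B^{\otimes(r+1)}$, and thereby acts on $V_B^{\otimes r}\cong V_B^{\otimes r}\otimes v_n$. These actions commute with those of $\mathrm{Sym}(n)$ and $\mathrm{Sym}(n-1)$ respectively. *)

theory Defs
  imports "HOL-Algebra.Ring" "HOL-Algebra.Sym_Groups" "HOL-Library.FuncSet" "HOL-Library.Disjoint_Sets"
begin

text \<open>
  The coefficient ring is a type of sort \<open>{comm_ring, comm_monoid_mult}\<close>, i.e. a commutative ring
  with \<open>1\<close>. The class \<open>comm_ring_1\<close> is avoided because it demands \<open>0 \<noteq> 1\<close> and so excludes the
  zero ring.
\<close>

text \<open>Coordinate functions; this is the free module on \<open>S\<close> only for finite \<open>S\<close>, as in all uses below.\<close>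

definition free_module :: "'s set \<Rightarrow> ('s \<Rightarrow> 'b::{comm_ring,comm_monoid_mult}) set" where
  "free_module S = {x. \<forall>s. s \<notin> S \<longrightarrow> x s = 0}"

definition basis_vec :: "'s \<Rightarrow> 's \<Rightarrow> 'b::{comm_ring,comm_monoid_mult}" where
  "basis_vec s = (\<lambda>t. if t = s then 1 else 0)"

text \<open>The linear map on \<open>free_module S\<close> that sends the basis vector of \<open>s \<in> S\<close> to \<open>f s\<close>.\<close>

definition lin_ext ::
    "'s set \<Rightarrow> ('s \<Rightarrow> 't \<Rightarrow> 'b) \<Rightarrow> ('s \<Rightarrow> 'b) \<Rightarrow> 't \<Rightarrow> 'b::{comm_ring,comm_monoid_mult}" where
  "lin_ext S f x = (\<lambda>t. \<Sum>s\<in>S. x s * f s t)"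

definition linear_endos :: "'s set \<Rightarrow> (('s \<Rightarrow> 'b) \<Rightarrow> ('s \<Rightarrow> 'b::{comm_ring,comm_monoid_mult})) set" where
  "linear_endos S = {f \<in> free_module S \<rightarrow>\<^sub>E free_module S.
     (\<forall>x\<in>free_module S. \<forall>y\<in>free_module S. f (\<lambda>s. x s + y s) = (\<lambda>s. f x s + f y s)) \<and>
     (\<forall>c. \<forall>x\<in>free_module S. f (\<lambda>s. c * x s) = (\<lambda>s. c * f x s))}"

text \<open>\<open>End\<^sub>A(M)\<close> for \<open>M = free_module S\<close>, where the algebra \<open>A\<close> acts on \<open>M\<close> via \<open>act\<close>.\<close>

definition module_End ::
    "('a, 'm) partial_object_scheme \<Rightarrow> ('a \<Rightarrow> ('s \<Rightarrow> 'b) \<Rightarrow> ('s \<Rightarrow> 'b)) \<Rightarrow> 's set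
      \<Rightarrow> (('s \<Rightarrow> 'b) \<Rightarrow> ('s \<Rightarrow> 'b::{comm_ring,comm_monoid_mult})) set" where
  "module_End A act S = {f \<in> linear_endos S.
     \<forall>a\<in>carrier A. \<forall>x\<in>free_module S. f (act a x) = act a (f x)}"

definition group_algebra ::
    "('g, 'm) monoid_scheme \<Rightarrow> ('g \<Rightarrow> 'b::{comm_ring,comm_monoid_mult}) ring" where
  "group_algebra G =
     \<lparr>carrier = free_module (carrier G),
      monoid.mult = (\<lambda>x y t. \<Sum>g\<in>carrier G. \<Sum>h\<in>carrier G. x g * y h * basis_vec (g \<otimes>\<^bsub>G\<^esub> h) t),
      one = basis_vec \<one>\<^bsub>G\<^esub>,
      zero = (\<lambda>t. 0),
      add = (\<lambda>x y t. x t + y t)\<rparr>"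

definition sym_group_fixing_last :: "nat \<Rightarrow> (nat \<Rightarrow> nat) monoid" where
  "sym_group_fixing_last n = (sym_group n)\<lparr>carrier := {\<sigma> \<in> carrier (sym_group n). \<sigma> n = n}\<rparr>"

text \<open>The vertex \<open>k\<close> is \<open>Inl k\<close> and the vertex \<open>k'\<close> is \<open>Inr k\<close>.\<close>

type_synonym vertex = "nat + nat"

definition diagrams :: "nat \<Rightarrow> vertex set set set" where
  "diagrams r = {d. partition_on ({1..r} <+> {1..r}) d}"

definition identity_diagram :: "nat \<Rightarrow> vertex set set" where
  "identity_diagram r = (\<lambda>k. {Inl k, Inr k}) ` {1..r}"

datatype row = Top | Middle | Bottom

definition place_upper :: "vertex \<Rightarrow> row \<times> nat" where
  "place_upper = case_sum (Pair Top) (Pair Middle)"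

definition place_lower :: "vertex \<Rightarrow> row \<times> nat" where
  "place_lower = case_sum (Pair Middle) (Pair Bottom)"

text \<open>
  The connected components of the three-row graph obtained by placing \<open>d1\<close> above \<open>d2\<close>. Every vertex
  lies in a block, so the transitive closure below is already an equivalence relation.
\<close>

definition stacked_components ::
    "nat \<Rightarrow> vertex set set \<Rightarrow> vertex set set \<Rightarrow> (row \<times> nat) set set" where
  "stacked_components r d1 d2 =
     (UNIV \<times> {1..r}) //
       {(u, w). \<exists>b \<in> (`) place_upper ` d1 \<union> (`) place_lower ` d2. u \<in> b \<and> w \<in> b}\<^sup>+"

definition diagram_comp :: "nat \<Rightarrow> vertex set set \<Rightarrow> vertex set set \<Rightarrow> vertex set set" where
  "diagram_comp r d1 d2 =
     (\<lambda>C. case_sum (Pair Top) (Pair Bottom) -` C) ` stacked_components r d1 d2 - {{}}"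

definition middle_components :: "nat \<Rightarrow> vertex set set \<Rightarrow> vertex set set \<Rightarrow> nat" where
  "middle_components r d1 d2 = card {C \<in> stacked_components r d1 d2. C \<subseteq> {Middle} \<times> {1..r}}"

definition partition_algebra ::
    "'b \<Rightarrow> nat \<Rightarrow> (vertex set set \<Rightarrow> 'b::{comm_ring,comm_monoid_mult}) ring" where
  "partition_algebra \<delta> r =
     \<lparr>carrier = free_module (diagrams r),
      monoid.mult = (\<lambda>x y t. \<Sum>d1\<in>diagrams r. \<Sum>d2\<in>diagrams r.
        x d1 * y d2 * (\<delta> ^ middle_components r d1 d2 * basis_vec (diagram_comp r d1 d2) t)),
      one = basis_vec (identity_diagram r),
      zero = (\<lambda>t. 0),
      add = (\<lambda>x y t. x t + y t)\<rparr>"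

definition half_diagrams :: "nat \<Rightarrow> vertex set set set" where
  "half_diagrams r = {d \<in> diagrams (Suc r). \<exists>b\<in>d. Inl (Suc r) \<in> b \<and> Inr (Suc r) \<in> b}"

text \<open>\<open>half_partition_algebra \<delta> r\<close> is \<open>P\<^bsub>r+1/2\<^esub>(\<delta>)\<close>, a subalgebra of \<open>P\<^bsub>r+1\<^esub>(\<delta>)\<close>.\<close>

definition half_partition_algebra ::
    "'b \<Rightarrow> nat \<Rightarrow> (vertex set set \<Rightarrow> 'b::{comm_ring,comm_monoid_mult}) ring" where
  "half_partition_algebra \<delta> r =
     (partition_algebra \<delta> (Suc r))\<lparr>carrier := free_module (half_diagrams r)\<rparr>"

text \<open>\<open>n \<cdot> 1\<close>; the constant \<open>of_nat\<close> is only available in rings with \<open>0 \<noteq> 1\<close>.\<close>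

definition nat_in_ring :: "nat \<Rightarrow> 'b::{comm_ring,comm_monoid_mult}" where
  "nat_in_ring n = (\<Sum>k=1..n. 1)"

text \<open>
  The tensor power \<open>V\<^sup>\<otimes>\<^sup>r\<close> of the free module \<open>V\<close> with basis \<open>v\<^sub>1, \<dots>, v\<^sub>n\<close> is represented in
  coordinates, as \<open>free_module (multi_index n r)\<close>: the basis vector of the multi-index \<open>i\<close> is
  \<open>v\<^bsub>i 1\<^esub> \<otimes> \<dots> \<otimes> v\<^bsub>i r\<^esub>\<close>.
\<close>

definition multi_index :: "nat \<Rightarrow> nat \<Rightarrow> (nat \<Rightarrow> nat) set" where
  "multi_index n r = {1..r} \<rightarrow>\<^sub>E {1..n}"

definition perm_action ::
    "nat \<Rightarrow> nat \<Rightarrow> (nat \<Rightarrow> nat) \<Rightarrow> ((nat \<Rightarrow> nat) \<Rightarrow> 'b) \<Rightarrow> ((nat \<Rightarrow> nat) \<Rightarrow> 'b::{comm_ring,comm_monoid_mult})" where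
  "perm_action n r \<sigma> = lin_ext (multi_index n r) (\<lambda>i. basis_vec (compose {1..r} \<sigma> i))"

text \<open>
  The natural map from the group algebra of a group \<open>G\<close> of permutations of \<open>{1..n}\<close> to the
  endomorphisms of tensor space.
\<close>

definition perm_representation ::
    "(nat \<Rightarrow> nat, 'm) monoid_scheme \<Rightarrow> nat \<Rightarrow> nat \<Rightarrow> ((nat \<Rightarrow> nat) \<Rightarrow> 'b)
      \<Rightarrow> (((nat \<Rightarrow> nat) \<Rightarrow> 'b) \<Rightarrow> ((nat \<Rightarrow> nat) \<Rightarrow> 'b::{comm_ring,comm_monoid_mult}))" where
  "perm_representation G n r a =
     (\<lambda>x\<in>free_module (multi_index n r). lin_ext (carrier G) (\<lambda>\<sigma>. perm_action n r \<sigma> x) a)"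

text \<open>Labelling vertex \<open>k\<close> by \<open>i k\<close> and vertex \<open>k'\<close> by \<open>j k\<close> is constant on every block of \<open>d\<close>.\<close>

definition constant_on_blocks :: "vertex set set \<Rightarrow> (nat \<Rightarrow> nat) \<Rightarrow> (nat \<Rightarrow> nat) \<Rightarrow> bool" where
  "constant_on_blocks d i j \<longleftrightarrow> (\<forall>b\<in>d. \<forall>u\<in>b. \<forall>w\<in>b. case_sum i j u = case_sum i j w)"

definition diagram_action ::
    "nat \<Rightarrow> nat \<Rightarrow> vertex set set \<Rightarrow> ((nat \<Rightarrow> nat) \<Rightarrow> 'b) \<Rightarrow> ((nat \<Rightarrow> nat) \<Rightarrow> 'b::{comm_ring,comm_monoid_mult})" where
  "diagram_action n r d = lin_ext (multi_index n r)
     (\<lambda>j t. \<Sum>i | i \<in> multi_index n r \<and> constant_on_blocks d i j. basis_vec i t)"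

definition partition_action ::
    "nat \<Rightarrow> nat \<Rightarrow> (vertex set set \<Rightarrow> 'b) \<Rightarrow> ((nat \<Rightarrow> nat) \<Rightarrow> 'b)
      \<Rightarrow> ((nat \<Rightarrow> nat) \<Rightarrow> 'b::{comm_ring,comm_monoid_mult})" where
  "partition_action n r a x = lin_ext (diagrams r) (\<lambda>d. diagram_action n r d x) a"

text \<open>The embedding \<open>x \<mapsto> x \<otimes> v\<^sub>n\<close> of \<open>V\<^sup>\<otimes>\<^sup>r\<close> into the \<open>(r+1)\<close>-st tensor power.\<close>

definition tensor_last ::
    "nat \<Rightarrow> nat \<Rightarrow> ((nat \<Rightarrow> nat) \<Rightarrow> 'b) \<Rightarrow> ((nat \<Rightarrow> nat) \<Rightarrow> 'b::{comm_ring,comm_monoid_mult})" where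
  "tensor_last n r = lin_ext (multi_index n r) (\<lambda>i. basis_vec (i(Suc r := n)))"

definition half_partition_action ::
    "nat \<Rightarrow> nat \<Rightarrow> (vertex set set \<Rightarrow> 'b) \<Rightarrow> ((nat \<Rightarrow> nat) \<Rightarrow> 'b)
      \<Rightarrow> ((nat \<Rightarrow> nat) \<Rightarrow> 'b::{comm_ring,comm_monoid_mult})" where
  "half_partition_action n r a x =
     inv_into (free_module (multi_index n r)) (tensor_last n r)
       (partition_action n (Suc r) a (tensor_last n r x))"

end

theory Submission
  imports Defs "HOL-Library.Function_Algebras" "HOL-Combinatorics.Permutations" "Jordan_Normal_Form.Determinant"
begin

text \<open>
  In coordinates an endomorphism of tensor space is a matrix \<open>\<phi> i j\<close> indexed by multi-indices. Testing
  it against the diagrams that tie two columns together shows that \<open>\<phi> i j = 0\<close> unless \<open>i\<close> and \<open>j\<close>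
  have the same coincidences, i.e. unless the pairs \<open>(j k, i k)\<close> form a partial permutation \<open>R\<close> of
  \<open>{1..n}\<close>; diagrams that relabel the tensor factors show that the entry depends on \<open>R\<close> only, say
  \<open>\<phi> i j = w R\<close>, and that \<open>w R\<close> is the sum of \<open>w (R \<union> {(x, y)})\<close> over all free \<open>y\<close>, for each free
  \<open>x\<close>, and dually. It remains to show that such a coherent \<open>w\<close>, given on partial permutations of
  size at most \<open>k\<close>, has the form \<open>w R = \<Sum> {c \<sigma> | \<sigma> extends R}\<close> over any abelian group.

  An inclusion-exclusion argument rewrites \<open>w R\<close> in terms of smaller partial permutations whenever
  \<open>R\<close> contains an increasing sequence with values up to \<open>i\<close> (or, dually, positions up to \<open>i\<close>) that is
  longer than the number of unused values (positions) up to \<open>i\<close>. Inverse Schensted insertion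
  injects the remaining partial permutations into the symmetric group, so there are at most \<open>n!\<close> of
  them. They span the integer-valued functions on the symmetric group, which has rank \<open>n!\<close>; hence
  their values can be prescribed freely by a choice of \<open>c\<close>, and \<open>w\<close> is determined by its values on them.
\<close>

section \<open>Coherent functions on partial permutations\<close>

text \<open>Over an arbitrary coefficient ring there is no division and no dimension count, and for
  \<open>k < n\<close> the function \<open>w\<close> has no prescribed values on whole permutations
  from which \<open>c\<close> could be read off. What saves the argument is that a rewriting step
  produces only partial permutations of at most the same size, so it stays where \<open>w\<close> is
  coherent, and that its coefficients are integers. It is therefore used twice. With values in the
  integer functions on permutations and \<open>k = n\<close> it writes the indicator of one
  permutation as an integer combination of indicators of partial permutations on which reverse
  insertion succeeds. These combinations form a one-sided inverse of the incidence matrix, and the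
  bound \<open>n!\<close> makes it two-sided; its integer entries act on any abelian group and
  define \<open>c\<close>. With the subgroup \<open>{0}\<close> the same rewriting carries the
  vanishing of \<open>w\<close> minus the sum over extensions to all partial permutations of size at
  most \<open>k\<close>. The link to insertion is that each place where reverse insertion gets stuck
  exhibits an increasing sequence that is too long.\<close>

definition matching :: "nat \<Rightarrow> (nat \<times> nat) set \<Rightarrow> bool" where
  "matching n R \<longleftrightarrow> R \<subseteq> {1..n} \<times> {1..n} \<and> inj_on fst R \<and> inj_on snd R"

text \<open>The condition is \<open>card R < k\<close> because the sums involve matchings of size
  \<open>card R + 1\<close>. On larger matchings and on other sets \<open>w\<close> is
  arbitrary.\<close>

definition coherent :: "nat \<Rightarrow> nat \<Rightarrow> ((nat \<times> nat) set \<Rightarrow> 'a::ab_group_add) \<Rightarrow> bool" where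
  "coherent n k w \<longleftrightarrow> (\<forall>R. matching n R \<and> card R < k \<longrightarrow>
     (\<forall>x\<in>{1..n} - fst ` R. w R = (\<Sum>y\<in>{1..n} - snd ` R. w (insert (x, y) R))) \<and>
     (\<forall>y\<in>{1..n} - snd ` R. w R = (\<Sum>x\<in>{1..n} - fst ` R. w (insert (x, y) R))))"

text \<open>First components are positions, second ones values. On a matching this is an increasing
  sequence; without injectivity the condition is not symmetric under converse.\<close>

definition chain :: "(nat \<times> nat) set \<Rightarrow> bool" where
  "chain C \<longleftrightarrow> (\<forall>p\<in>C. \<forall>q\<in>C. fst p < fst q \<longrightarrow> snd p < snd q)"

lemma matching_finite: "matching n R \<Longrightarrow> finite R"
  unfolding matching_def by (meson finite_SigmaI finite_atLeastAtMost finite_subset)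

lemma finite_matchings: "finite {R. matching n R}"
proof -
  have "{R. matching n R} \<subseteq> Pow ({1..n} \<times> {1..n})"
    by (auto simp: matching_def)
  then show ?thesis by (rule finite_subset) simp
qed

lemma matching_subset: "matching n R \<Longrightarrow> Q \<subseteq> R \<Longrightarrow> matching n Q"
  unfolding matching_def by (meson inj_on_subset order_trans)

lemma matching_insert:
  assumes "matching n R" "x \<in> {1..n} - fst ` R" "y \<in> {1..n} - snd ` R"
  shows "matching n (insert (x, y) R)"
  using assms unfolding matching_def by (auto simp: inj_on_def rev_image_eqI) 

lemma matching_Un:
  assumes "matching n q" "F \<subseteq> {1..n} \<times> {1..n}" "inj_on fst F" "inj_on snd F"
    and "fst ` q \<inter> fst ` F = {}" "snd ` q \<inter> snd ` F = {}"
  shows "matching n (q \<union> F)"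
proof -
  have "fst ` (q - F) \<inter> fst ` (F - q) = {}" "snd ` (q - F) \<inter> snd ` (F - q) = {}"
    using assms(5,6) by blast+
  then show ?thesis using assms(1-4) by (simp add: inj_on_Un matching_def)
qed

lemma fst_converse: "fst ` (R\<inverse>) = snd ` R" and snd_converse: "snd ` (R\<inverse>) = fst ` R"
  by (force simp: image_iff)+

lemma matching_converse: "matching n R \<Longrightarrow> matching n (R\<inverse>)"
  unfolding matching_def inj_on_def by fastforce

text \<open>Positions and values play symmetric roles, so the rewriting is carried out only for
  crowded values; crowded positions follow by transposing \<open>w\<close>.\<close>

lemma coherent_converse:
  assumes "coherent n k w" shows "coherent n k (\<lambda>R. w (R\<inverse>))"
  unfolding coherent_def
proof (intro allI impI)
  fix R assume "matching n R \<and> card R < k"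
  then have *: "matching n (R\<inverse>)" "card (R\<inverse>) < k"
    by (auto intro: matching_converse simp: card_inverse)
  have ins: "(insert (x, y) R)\<inverse> = insert (y, x) (R\<inverse>)" for x y by auto
  show "(\<forall>x\<in>{1..n} - fst ` R. w (R\<inverse>) = (\<Sum>y\<in>{1..n} - snd ` R. w ((insert (x, y) R)\<inverse>))) \<and>
     (\<forall>y\<in>{1..n} - snd ` R. w (R\<inverse>) = (\<Sum>x\<in>{1..n} - fst ` R. w ((insert (x, y) R)\<inverse>)))"
    using assms[unfolded coherent_def, rule_format, OF conjI[OF *]]
    unfolding ins fst_converse snd_converse by blast
qed

section \<open>Inclusion-exclusion for coherent functions\<close>

definition full_matchings :: "nat set \<Rightarrow> nat set \<Rightarrow> (nat \<times> nat) set set" where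
  "full_matchings T S = {F. F \<subseteq> T \<times> S \<and> inj_on fst F \<and> inj_on snd F \<and> fst ` F = T}"

lemma full_matchings_empty: "full_matchings {} S = {{}}"
  unfolding full_matchings_def by auto

lemma finite_full_matchings: "finite T \<Longrightarrow> finite S \<Longrightarrow> finite (full_matchings T S)"
  by (rule finite_subset[of _ "Pow (T \<times> S)"]) (auto simp: full_matchings_def)

text \<open>\<open>full_matchings T S\<close> consists of the graphs of the injections from
  \<open>T\<close> to \<open>S\<close>. An injection on \<open>insert t T\<close> is one on
  \<open>T\<close> together with a value for \<open>t\<close> that is not yet taken; this drives the
  induction in \<open>exchange\<close>.\<close>

lemma sum_full_matchings_insert:
  fixes G :: "(nat \<times> nat) set \<Rightarrow> 'a::ab_group_add"
  assumes "finite T" "finite S" "t \<notin> T"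
  shows "(\<Sum>F\<in>full_matchings (insert t T) S. G F)
       = (\<Sum>F\<in>full_matchings T S. \<Sum>s\<in>S - snd ` F. G (insert (t, s) F))"
proof -
  let ?I = "SIGMA F:full_matchings T S. S - snd ` F"
  let ?h = "\<lambda>(F, s). insert (t, s) F"
  have bij: "bij_betw ?h ?I (full_matchings (insert t T) S)"
    unfolding bij_betw_def
  proof
    show "inj_on ?h ?I"
    proof (rule inj_onI, clarify)
      fix F s F' s'
      assume F: "F \<in> full_matchings T S" "F' \<in> full_matchings T S"
        and eq: "insert (t, s) F = insert (t, s') F'"
      have nt: "(t, a) \<notin> F" "(t, a) \<notin> F'" for a
        using F assms(3) by (auto simp: full_matchings_def)
      have "s = s'" using eq nt by blast
      moreover have "F = F'"
        using eq nt \<open>s = s'\<close> by (metis insert_ident)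
      ultimately show "F = F' \<and> s = s'" by simp
    qed
    show "?h ` ?I = full_matchings (insert t T) S"
    proof
      show "?h ` ?I \<subseteq> full_matchings (insert t T) S"
      proof clarify
        fix F s assume F: "F \<in> full_matchings T S" and s: "s \<in> S" "s \<notin> snd ` F"
        have nt: "t \<notin> fst ` F" using F assms(3) by (auto simp: full_matchings_def)
        have "inj_on fst (insert (t, s) F)" "inj_on snd (insert (t, s) F)"
          using F s nt by (auto simp: full_matchings_def)
        then show "insert (t, s) F \<in> full_matchings (insert t T) S"
          using F s by (auto simp: full_matchings_def)
      qed
    next
      show "full_matchings (insert t T) S \<subseteq> ?h ` ?I"
      proof
        fix F assume F: "F \<in> full_matchings (insert t T) S"
        then obtain s where s: "(t, s) \<in> F" by (force simp: full_matchings_def)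
        let ?F = "F - {(t, s)}"
        have inj: "inj_on fst F" "inj_on snd F" and sub: "F \<subseteq> insert t T \<times> S"
          and dom: "fst ` F = insert t T"
          using F by (auto simp: full_matchings_def)
        have un: "p = (t, s)" if "p \<in> F" "fst p = t" for p
          using inj(1) s that by (auto simp: inj_on_def)
        have "?F \<subseteq> T \<times> S" using sub un by fastforce
        moreover have "fst ` ?F = T"
        proof
          show "fst ` ?F \<subseteq> T" using \<open>?F \<subseteq> T \<times> S\<close> by auto
          show "T \<subseteq> fst ` ?F"
          proof
            fix a assume "a \<in> T"
            then obtain p where "p \<in> F" "fst p = a" using dom by force
            then show "a \<in> fst ` ?F" using \<open>a \<in> T\<close> assms(3) by force
          qed
        qed
        moreover have "inj_on fst ?F" "inj_on snd ?F" using inj by (auto simp: inj_on_def)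
        ultimately have "?F \<in> full_matchings T S" by (simp add: full_matchings_def)
        moreover have "s \<in> S - snd ` ?F" using inj s sub by (auto simp: inj_on_def) (metis fst_conv insertE prod.inject snd_conv)
        ultimately have "(?F, s) \<in> ?I" by simp
        moreover have "F = ?h (?F, s)" using s by auto
        ultimately show "F \<in> ?h ` ?I" by blast
      qed
    qed
  qed
  have "(\<Sum>F\<in>full_matchings T S. \<Sum>s\<in>S - snd ` F. G (insert (t, s) F)) = (\<Sum>p\<in>?I. G (?h p))"
    using assms by (subst sum.Sigma) (auto simp: finite_full_matchings case_prod_unfold)
  also have "\<dots> = (\<Sum>F\<in>full_matchings (insert t T) S. G F)"
    by (rule sum.reindex_bij_betw[OF bij])
  finally show ?thesis by simp
qed

text \<open>The subgroup is a parameter because the rewriting is used with two of them: the integer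
  span of the indicators of standard matchings, and \<open>{0}\<close>.\<close>

locale add_subgroup =
  fixes H :: "'a::ab_group_add set"
  assumes zero: "0 \<in> H" and diff: "\<And>a b. a \<in> H \<Longrightarrow> b \<in> H \<Longrightarrow> a - b \<in> H"
begin

lemma add: "a \<in> H \<Longrightarrow> b \<in> H \<Longrightarrow> a + b \<in> H"
  using diff[of a "0 - b"] diff[of 0 b] zero by simp

lemma sum: "(\<And>i. i \<in> I \<Longrightarrow> g i \<in> H) \<Longrightarrow> (\<Sum>i\<in>I. g i) \<in> H"
  by (induction I rule: infinite_finite_induct) (auto simp: zero add)

text \<open>
  Inclusion-exclusion: the sum counts the extensions of \<open>q\<close> that map \<open>T\<close> into \<open>S\<close>, and these are the
  ones that send no element of \<open>T\<close> outside \<open>S\<close>.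
\<close>

lemma exchange:
  assumes coh: "coherent n k w" and "finite T" "T \<subseteq> {1..n}"
    and "matching n q" "T \<inter> fst ` q = {}" "S \<subseteq> {1..n} - snd ` q" "card q + card T \<le> k"
    and "\<And>g. g \<subseteq> T \<times> ({1..n} - S) \<Longrightarrow> matching n (q \<union> g) \<Longrightarrow> w (q \<union> g) \<in> H"
  shows "(\<Sum>F\<in>full_matchings T S. w (q \<union> F)) \<in> H"
  using assms(2-)
proof (induction T arbitrary: q rule: finite_induct)
  case empty
  then show ?case using empty(6)[of "{}"] by (simp add: full_matchings_empty)
next
  case (insert t T)
  let ?U = "{1..n} - snd ` q"
  have finS: "finite S" using insert.prems(4) finite_subset by blast
  have fq: "finite q" using insert.prems(2) by (rule matching_finite)
  \<comment> \<open>Coherence at \<open>t\<close> sums over every free value. The values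
    \<open>u\<close> outside \<open>S\<close> go to the other side, where \<open>(t, u)\<close>
    joins the fixed part \<open>q\<close>; both remaining sums then run over injections on
    \<open>T\<close> alone.\<close>
  have split: "(\<Sum>s\<in>S - snd ` F. w (insert (t, s) (q \<union> F)))
       = w (q \<union> F) - (\<Sum>u\<in>?U - S. w (insert (t, u) q \<union> F))" if F: "F \<in> full_matchings T S" for F
  proof -
    have sub: "F \<subseteq> T \<times> S" and inj: "inj_on fst F" "inj_on snd F" and dom: "fst ` F = T"
      using F by (auto simp: full_matchings_def)
    have finF: "finite F" using sub insert.hyps(1) finS by (meson finite_SigmaI finite_subset)
    have m: "matching n (q \<union> F)"
    proof (rule matching_Un[OF insert.prems(2)])
      show "F \<subseteq> {1..n} \<times> {1..n}" using sub insert.prems(1,4) by auto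
      show "fst ` q \<inter> fst ` F = {}" using dom insert.prems(3) by auto
      show "snd ` q \<inter> snd ` F = {}" using sub insert.prems(4) by force
    qed (use inj in auto)
    have "card F = card T" using dom inj(1) card_image by fastforce
    then have "card (q \<union> F) < k"
      using card_Un_le[of q F] insert.prems(5) insert.hyps by simp
    moreover have "t \<in> {1..n} - fst ` (q \<union> F)"
      using insert.prems dom insert.hyps by auto
    ultimately have "w (q \<union> F) = (\<Sum>y\<in>{1..n} - snd ` (q \<union> F). w (insert (t, y) (q \<union> F)))"
      using coh m by (simp add: coherent_def)
    also have "{1..n} - snd ` (q \<union> F) = (S - snd ` F) \<union> (?U - S)"
      using sub insert.prems(4) by auto
    also have "(\<Sum>y\<in>(S - snd ` F) \<union> (?U - S). w (insert (t, y) (q \<union> F)))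
       = (\<Sum>y\<in>S - snd ` F. w (insert (t, y) (q \<union> F))) + (\<Sum>y\<in>?U - S. w (insert (t, y) (q \<union> F)))"
      by (rule sum.union_disjoint) (use finS in auto)
    finally show ?thesis by simp
  qed
  have "(\<Sum>F\<in>full_matchings (insert t T) S. w (q \<union> F))
      = (\<Sum>F\<in>full_matchings T S. w (q \<union> F) - (\<Sum>u\<in>?U - S. w (insert (t, u) q \<union> F)))"
    using split by (simp add: sum_full_matchings_insert[OF insert.hyps(1) finS insert.hyps(2)])
  also have "\<dots> = (\<Sum>F\<in>full_matchings T S. w (q \<union> F))
      - (\<Sum>u\<in>?U - S. \<Sum>F\<in>full_matchings T S. w (insert (t, u) q \<union> F))"
    by (simp add: sum_subtractf sum.swap[of _ "full_matchings T S"])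
  also have "\<dots> \<in> H"
  proof (rule diff)
    show "(\<Sum>F\<in>full_matchings T S. w (q \<union> F)) \<in> H"
    proof (rule insert.IH)
      fix g assume "g \<subseteq> T \<times> ({1..n} - S)" "matching n (q \<union> g)"
      then show "w (q \<union> g) \<in> H" by (intro insert.prems(6)) auto
    qed (use insert.prems insert.hyps in auto)
    show "(\<Sum>u\<in>?U - S. \<Sum>F\<in>full_matchings T S. w (insert (t, u) q \<union> F)) \<in> H"
    proof (rule sum)
      fix u assume u: "u \<in> ?U - S"
      show "(\<Sum>F\<in>full_matchings T S. w (insert (t, u) q \<union> F)) \<in> H"
      proof (rule insert.IH)
        show "matching n (insert (t, u) q)"
          using insert.prems u by (intro matching_insert) auto
        show "card (insert (t, u) q) + card T \<le> k"
          using insert.prems(5) insert.hyps card_insert_le_m1[of "Suc (card q)" q "(t,u)"] fq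
          by (simp add: card_insert_if split: if_splits)
        fix g assume g: "g \<subseteq> T \<times> ({1..n} - S)" "matching n (insert (t, u) q \<union> g)"
        have "w (q \<union> insert (t, u) g) \<in> H"
          using g u by (intro insert.prems(6)) (auto simp: insert_commute)
        then show "w (insert (t, u) q \<union> g) \<in> H" by simp
      qed (use insert.prems insert.hyps u in auto)
    qed
  qed
  finally show ?case .
qed

end

section \<open>The rearrangement inequality\<close>

abbreviation pair_sum :: "(nat \<times> nat) set \<Rightarrow> nat" where
  "pair_sum R \<equiv> \<Sum>p\<in>R. fst p * snd p"

text \<open>Induction on the number of points. If \<open>F\<close> misses the greatest point
  \<open>p = (X, Y)\<close> of \<open>C\<close>, it is uncrossed there and then compared with
  \<open>C - {p}\<close>.\<close>

lemma chain_maximizes_pair_sum: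
  assumes "finite C" "chain C" "inj_on fst C" "inj_on snd C"
    and "inj_on fst F" "inj_on snd F" "fst ` F = fst ` C" "snd ` F = snd ` C"
  shows "F = C \<or> pair_sum F < pair_sum C"
  using assms
proof (induction "card C" arbitrary: C F)
  case 0
  then show ?case by simp
next
  case (Suc m)
  have "fst ` C \<noteq> {}" using Suc by auto
  then have "Max (fst ` C) \<in> fst ` C" using Suc by (intro Max_in) auto
  then obtain p where p: "p \<in> C" "fst p = Max (fst ` C)" by fastforce
  obtain X Y where XY: "p = (X, Y)" by force
  have lt: "fst q < X \<and> snd q < Y" if "q \<in> C" "q \<noteq> p" for q
  proof -
    have "fst q \<le> X" using p XY that Suc by simp
    moreover have "fst q \<noteq> X" using that p XY Suc.prems(3) by (auto simp: inj_on_def)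
    ultimately have "fst q < X" by simp
    moreover have "snd q < snd p"
      using Suc.prems(2)[unfolded chain_def, rule_format, OF that(1) p(1)] XY \<open>fst q < X\<close> by simp
    ultimately show ?thesis using XY by simp
  qed
  have finF: "finite F" using Suc.prems by (metis finite_imageD finite_imageI)
  let ?C = "C - {p}"
  have C': "m = card ?C" "finite ?C" "chain ?C" "inj_on fst ?C" "inj_on snd ?C"
    using Suc.hyps(2) Suc.prems p by (auto simp: chain_def inj_on_def)
  have fC: "fst ` ?C = fst ` C - {X}"
  proof -
    have "fst ` (C - {p}) = fst ` C - fst ` {p}"
      by (rule inj_on_image_set_diff[OF Suc.prems(3)]) (use p in auto)
    then show ?thesis using XY by simp
  qed
  have sC: "snd ` ?C = snd ` C - {Y}"
  proof -
    have "snd ` (C - {p}) = snd ` C - snd ` {p}"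
      by (rule inj_on_image_set_diff[OF Suc.prems(4)]) (use p in auto)
    then show ?thesis using XY by simp
  qed
  have sumC: "pair_sum C = X * Y + pair_sum ?C"
    using Suc.prems(1) p XY by (simp add: sum.remove)
  have ltT: "x < X" if "x \<in> fst ` C" "x \<noteq> X" for x using lt that XY by force
  have ltS: "y < Y" if "y \<in> snd ` C" "y \<noteq> Y" for y using lt that XY by force
  show ?case
  proof (cases "p \<in> F")
    case True
    let ?F = "F - {p}"
    have "fst ` ?F = fst ` F - fst ` {p}"
      by (rule inj_on_image_set_diff[OF Suc.prems(5)]) (use True in auto)
    moreover have "snd ` ?F = snd ` F - snd ` {p}"
      by (rule inj_on_image_set_diff[OF Suc.prems(6)]) (use True in auto)
    ultimately have "?F = ?C \<or> pair_sum ?F < pair_sum ?C"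
      using Suc.prems fC sC XY
      by (intro Suc.hyps(1)[OF C'(1-5)]) (auto simp: inj_on_def)
    moreover have "pair_sum F = X * Y + pair_sum ?F"
      using finF True XY by (simp add: sum.remove)
    moreover have "F = C" if "?F = ?C" using that True p(1) by blast
    ultimately show ?thesis using sumC by linarith
  next
    case False
    have "X \<in> fst ` F" "Y \<in> snd ` F" using Suc.prems p XY by force+
    then obtain y1 x1 where yx: "(X, y1) \<in> F" "(x1, Y) \<in> F" by force
    have ne: "y1 \<noteq> Y" "x1 \<noteq> X" using yx False XY by auto
    have y1: "y1 < Y" and x1: "x1 < X"
      using ltS[of y1] ltT[of x1] ne rev_image_eqI[OF yx(1), of y1 snd] rev_image_eqI[OF yx(2), of x1 fst] Suc.prems(7,8)
      by auto
    \<comment> \<open>\<open>(X, y1)\<close> and \<open>(x1, Y)\<close> are exchanged for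
      \<open>p\<close> and \<open>(x1, y1)\<close>, which raises the sum by
      \<open>(X - x1) * (Y - y1)\<close>; \<open>?F\<close> is the result without
      \<open>p\<close>.\<close>
    let ?G = "F - {(X, y1), (x1, Y)}" and ?F = "insert (x1, y1) (F - {(X, y1), (x1, Y)})"
    have injF: "\<And>a b. a \<in> F \<Longrightarrow> b \<in> F \<Longrightarrow> fst a = fst b \<Longrightarrow> a = b"
       "\<And>a b. a \<in> F \<Longrightarrow> b \<in> F \<Longrightarrow> snd a = snd b \<Longrightarrow> a = b"
      using Suc.prems(5,6) by (auto simp: inj_on_def)
    have new: "x1 \<notin> fst ` ?G" "y1 \<notin> snd ` ?G"
      using injF yx by fastforce+
    have fG: "fst ` ?G = fst ` F - {X, x1}" 
      using inj_on_image_set_diff[OF Suc.prems(5), of F "{(X, y1), (x1, Y)}"] yx by simp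
    have sG: "snd ` ?G = snd ` F - {y1, Y}" 
      using inj_on_image_set_diff[OF Suc.prems(6), of F "{(X, y1), (x1, Y)}"] yx by simp
    have "x1 \<in> fst ` F" "y1 \<in> snd ` F" using yx by force+
    then have "fst ` ?F = fst ` ?C" "snd ` ?F = snd ` ?C"
      using fG sG fC sC ne Suc.prems(7,8) by auto
    moreover have "inj_on fst ?F" "inj_on snd ?F"
      using new Suc.prems(5,6) by (auto intro: inj_on_subset)
    ultimately have "?F = ?C \<or> pair_sum ?F < pair_sum ?C"
      by (intro Suc.hyps(1)[OF C'(1-5)])
    then have le: "pair_sum ?F \<le> pair_sum ?C" by fastforce
    have "(x1, y1) \<notin> ?G" using new by force
    then have "pair_sum ?F = x1 * y1 + pair_sum ?G" using finF by simp
    moreover have "pair_sum F = X * y1 + (x1 * Y + pair_sum ?G)"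
    proof -
      have "pair_sum F = X * y1 + pair_sum (F - {(X, y1)})"
        using finF yx by (simp add: sum.remove)
      also have "pair_sum (F - {(X, y1)}) = x1 * Y + pair_sum (F - {(X, y1)} - {(x1, Y)})"
        using finF yx ne by (subst sum.remove[of _ "(x1, Y)"]) auto
      also have "F - {(X, y1)} - {(x1, Y)} = ?G" by auto
      finally show ?thesis .
    qed
    moreover have "X * y1 + x1 * Y < x1 * y1 + X * Y"
    proof -
      obtain a b where "X = x1 + a" "Y = y1 + b" "a > 0" "b > 0"
        using x1 y1 by (metis add.commute less_imp_add_positive)
      then show ?thesis by (simp add: algebra_simps)
    qed
    ultimately show ?thesis using le sumC by linarith
  qed
qed


section \<open>Rewriting overcrowded partial permutations\<close>

definition overcrowded :: "(nat \<times> nat) set \<Rightarrow> bool" where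
  "overcrowded R \<longleftrightarrow> (\<exists>C i. C \<subseteq> R \<and> chain C \<and> snd ` C \<subseteq> {..i} \<and> card ({1..i} - snd ` R) < card C)"

text \<open>Read as binary numerals: a set of values with an element above \<open>i\<close>
  outweighs every set of values up to \<open>i\<close>, whatever its other elements are. Positions
  are counted as well, which makes the weight invariant under converse.\<close>

definition dyadic_weight :: "(nat \<times> nat) set \<Rightarrow> nat" where
  "dyadic_weight R = (\<Sum>x\<in>fst ` R. 2 ^ x) + (\<Sum>y\<in>snd ` R. 2 ^ y)"

text \<open>
  The second component is truncated subtraction; it reverses the order of the weights because the
  weight of a matching is below \<open>2 ^ (n + 2)\<close>.
\<close>

definition matching_order :: "nat \<Rightarrow> ((nat \<times> nat) set \<times> (nat \<times> nat) set) set" where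
  "matching_order n = measures [card, \<lambda>R. 2 ^ (n + 2) - dyadic_weight R, pair_sum]"

lemma wf_matching_order: "wf (matching_order n)"
  by (simp add: matching_order_def)

lemma matching_order_converse:
  "(A\<inverse>, B\<inverse>) \<in> matching_order n \<longleftrightarrow> (A, B) \<in> matching_order n"
proof -
  have "pair_sum (R\<inverse>) = pair_sum R" for R
    by (rule sum.reindex_bij_witness[of _ prod.swap prod.swap]) auto
  moreover have "dyadic_weight (R\<inverse>) = dyadic_weight R" for R
    by (simp add: dyadic_weight_def fst_converse snd_converse)
  ultimately show ?thesis by (simp add: matching_order_def)
qed

lemma sum_power2_less: "finite A \<Longrightarrow> A \<subseteq> {..i} \<Longrightarrow> (\<Sum>x\<in>A. 2 ^ x) < (2::nat) ^ Suc i"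
proof -
  assume "finite A" "A \<subseteq> {..i}"
  then have "(\<Sum>x\<in>A. 2 ^ x) \<le> (\<Sum>x\<in>{..i}. (2::nat) ^ x)" by (intro sum_mono2) auto
  also have "\<dots> < 2 ^ Suc i" using sum_power2[of "Suc i"] by (simp add: atMost_atLeast0 atLeastLessThanSuc_atLeastAtMost)
  finally show ?thesis .
qed

lemma dyadic_weight_less:
  assumes "matching n R" shows "dyadic_weight R < 2 ^ (n + 2)"
proof -
  have "(\<Sum>x\<in>fst ` R. 2 ^ x) < (2::nat) ^ Suc n" "(\<Sum>x\<in>snd ` R. 2 ^ x) < (2::nat) ^ Suc n"
    using assms matching_finite[OF assms] by (auto intro!: sum_power2_less simp: matching_def simp del: power_Suc)
  then show ?thesis by (simp add: dyadic_weight_def)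
qed

context add_subgroup
begin

text \<open>\<open>exchange\<close> is applied to the positions and values of the chain
  \<open>C\<close>, with \<open>R - C\<close> kept fixed. Every other partial permutation that
  occurs is smaller in \<open>matching_order\<close>: it has fewer points, or as many points and a
  greater dyadic weight, or the same positions and values in an arrangement with smaller
  \<open>pair_sum\<close>. So \<open>w R\<close> is the only term left.\<close>

lemma overcrowded_reduction:
  assumes coh: "coherent n k w" and R: "matching n R" "card R \<le> k" "overcrowded R"
    and IH: "\<And>R'. matching n R' \<Longrightarrow> card R' \<le> k \<Longrightarrow> (R', R) \<in> matching_order n \<Longrightarrow> w R' \<in> H"
  shows "w R \<in> H"
proof -
  obtain C i where C: "C \<subseteq> R" "chain C" "snd ` C \<subseteq> {..i}" "card ({1..i} - snd ` R) < card C"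
    using R(3) by (auto simp: overcrowded_def)
  let ?q = "R - C" and ?T = "fst ` C" and ?S = "snd ` C"
  have finR: "finite R" and finC: "finite C"
    using matching_finite[OF R(1)] C(1) finite_subset by auto
  have injR: "inj_on fst R" "inj_on snd R" and subR: "R \<subseteq> {1..n} \<times> {1..n}"
    using R(1) by (auto simp: matching_def)
  have injC: "inj_on fst C" "inj_on snd C" using injR C(1) inj_on_subset by blast+
  have fq: "fst ` ?q = fst ` R - ?T" and sq: "snd ` ?q = snd ` R - ?S"
    using inj_on_image_set_diff[OF injR(1), of R C] inj_on_image_set_diff[OF injR(2), of R C] C(1)
    by auto
  have sub: "?T \<subseteq> fst ` R" "?S \<subseteq> snd ` R" using C(1) by (auto intro: image_mono)
  have q: "matching n ?q" using R(1) matching_subset by blast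
  have cR: "card R = card ?q + card C"
    using finR finC C(1) by (simp add: card_Diff_subset card_mono)
  have cT: "card ?T = card C" "card ?S = card C" using injC by (auto simp: card_image)
  have tot: "(\<Sum>F\<in>full_matchings ?T ?S. w (?q \<union> F)) \<in> H"
  proof (rule exchange[OF coh _ _ q])
    show "?T \<subseteq> {1..n}" "?S \<subseteq> {1..n} - snd ` ?q" using subR C(1) sq by auto
    show "?T \<inter> fst ` ?q = {}" using fq by auto
    show "card ?q + card ?T \<le> k" using cR cT R(2) by simp
    fix g assume g: "g \<subseteq> ?T \<times> ({1..n} - ?S)" and m: "matching n (?q \<union> g)"
    have fing: "finite g" using matching_finite[OF m] by simp
    have fg: "fst ` g \<subseteq> ?T" using g by auto
    have sg0: "snd ` g \<subseteq> {1..n} - ?S"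
      using image_mono[OF g, of snd] unfolding snd_image_times by (simp split: if_splits)
    have "fst ` ?q \<inter> fst ` g = {}" using fg fq by blast
    then have disj: "?q \<inter> g = {}" by blast
    have ig: "inj_on fst g" "inj_on snd g" using m by (auto simp: matching_def intro: inj_on_subset)
    have cg: "card g \<le> card C"
      using card_mono[OF _ fg] finC cT card_image[OF ig(1)] by simp
    have cqg: "card (?q \<union> g) = card ?q + card g"
      using finR fing disj by (simp add: card_Un_disjoint)
    show "w (?q \<union> g) \<in> H"
    proof (rule IH[OF m])
      show "card (?q \<union> g) \<le> k" using cqg cg cR R(2) by simp
      show "(?q \<union> g, R) \<in> matching_order n"
      proof (cases "card g = card C")
        case False
        then have "card (?q \<union> g) < card R" using cqg cg cR by simp
        then show ?thesis by (simp add: matching_order_def)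
      next
        case True
        have "fst ` g = ?T"
          using card_subset_eq[OF _ fg] finC True cT card_image[OF ig(1)] by simp
        then have f: "fst ` (?q \<union> g) = fst ` R" unfolding image_Un using fq sub(1) by blast
        have sg: "snd ` g \<inter> snd ` R = {}"
        proof -
          have eq: "?q - g = ?q" "g - ?q = g" using disj by blast+
          have "inj_on snd (?q \<union> g)" using m by (simp add: matching_def)
          then have "snd ` (?q - g) \<inter> snd ` (g - ?q) = {}" unfolding inj_on_Un by blast
          then show ?thesis using sq sg0 unfolding eq by blast
        qed
        have "\<not> snd ` g \<subseteq> {1..i} - snd ` R"
          using card_mono[of "{1..i} - snd ` R" "snd ` g"] C(4) True card_image[OF ig(2)] by auto
        then obtain y where y: "y \<in> snd ` g" "y \<notin> {1..i}" using sg by blast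
        then have "y \<in> {1..n}" using sg0 by blast
        then have "y > i" using y(2) by simp
        have "(\<Sum>z\<in>?S. 2 ^ z) < (2::nat) ^ Suc i" using finC C(3) by (intro sum_power2_less) auto
        also have "\<dots> \<le> 2 ^ y" using \<open>y > i\<close> by (intro power_increasing) auto
        also have "\<dots> \<le> (\<Sum>z\<in>snd ` g. 2 ^ z)"
          using fing y(1) by (intro member_le_sum) auto
        finally have lt: "(\<Sum>z\<in>?S. 2 ^ z) < (\<Sum>z\<in>snd ` g. (2::nat) ^ z)" .
        have "(\<Sum>z\<in>snd ` R. (2::nat) ^ z) = (\<Sum>z\<in>snd ` ?q. 2 ^ z) + (\<Sum>z\<in>?S. 2 ^ z)"
          using sum.subset_diff[of ?S "snd ` R" "\<lambda>z. (2::nat) ^ z"] finR C(1) sq by (simp add: image_mono)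
        moreover have "(\<Sum>z\<in>snd ` (?q \<union> g). (2::nat) ^ z) = (\<Sum>z\<in>snd ` ?q. 2 ^ z) + (\<Sum>z\<in>snd ` g. 2 ^ z)"
          unfolding image_Un using finR fing sg sq by (intro sum.union_disjoint) auto
        ultimately have "dyadic_weight R < dyadic_weight (?q \<union> g)"
          using lt f by (simp add: dyadic_weight_def)
        then have "2 ^ (n + 2) - dyadic_weight (?q \<union> g) < 2 ^ (n + 2) - dyadic_weight R"
          using dyadic_weight_less[OF m] by linarith
        moreover have "card (?q \<union> g) = card R" using cqg True cR by simp
        ultimately show ?thesis by (simp add: matching_order_def)
      qed
    qed
  qed (use finC in auto)
  have CM: "C \<in> full_matchings ?T ?S"
    using injC by (force simp: full_matchings_def)
  have finM: "finite (full_matchings ?T ?S)" using finC by (intro finite_full_matchings) auto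
  \<comment> \<open>These terms have the size, positions and values of \<open>R\<close>, so the
    first two measures tie and \<open>pair_sum\<close> decides.\<close>
  have other: "w (?q \<union> F) \<in> H" if F: "F \<in> full_matchings ?T ?S" "F \<noteq> C" for F
  proof -
    have F': "F \<subseteq> ?T \<times> ?S" "inj_on fst F" "inj_on snd F" "fst ` F = ?T"
      using F by (auto simp: full_matchings_def)
    have cF: "card F = card C" using card_image[OF F'(2)] F'(4) cT by simp
    have sF: "snd ` F = ?S"
      using F'(1) finC cF cT card_image[OF F'(3)] by (intro card_subset_eq) auto
    have m: "matching n (?q \<union> F)"
    proof (rule matching_Un[OF q _ F'(2,3)])
      show "F \<subseteq> {1..n} \<times> {1..n}" using F'(1) subR C(1) by fastforce
    qed (use fq sq F'(4) sF in auto)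
    have finF: "finite F" using finC F'(1) by (meson finite_SigmaI finite_imageI finite_subset)
    have "fst ` ?q \<inter> fst ` F = {}" using F'(4) fq by blast
    then have disj: "?q \<inter> F = {}" by blast
    have c: "card (?q \<union> F) = card R"
      using finR finF disj cF cR by (simp add: card_Un_disjoint)
    have "pair_sum F < pair_sum C"
      using chain_maximizes_pair_sum[OF finC C(2) injC F'(2,3,4) sF] F(2) by simp
    moreover have "pair_sum (?q \<union> F) = pair_sum ?q + pair_sum F"
      using finR finF disj by (intro sum.union_disjoint) auto
    moreover have "pair_sum R = pair_sum ?q + pair_sum C"
      using sum.subset_diff[OF C(1) finR] by simp
    moreover have "fst ` (?q \<union> F) = fst ` R" "snd ` (?q \<union> F) = snd ` R"
      unfolding image_Un fq sq F'(4) sF using C(1) by auto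
    then have "dyadic_weight (?q \<union> F) = dyadic_weight R"
      by (simp only: dyadic_weight_def)
    ultimately show ?thesis
      using c R(2) by (intro IH[OF m]) (simp_all add: matching_order_def)
  qed
  have "(\<Sum>F\<in>full_matchings ?T ?S. w (?q \<union> F)) - (\<Sum>F\<in>full_matchings ?T ?S - {C}. w (?q \<union> F)) \<in> H"
    using other by (intro diff[OF tot] sum) simp
  moreover have "(\<Sum>F\<in>full_matchings ?T ?S. w (?q \<union> F))
      = w (?q \<union> C) + (\<Sum>F\<in>full_matchings ?T ?S - {C}. w (?q \<union> F))"
    using sum.remove[OF finM CM] .
  moreover have "?q \<union> C = R" using C(1) by auto
  ultimately show ?thesis by simp
qed

text \<open>The rules for \<open>R\<close> and for its converse decrease the same order, since it is
  invariant under converse; so they can be mixed in one well-founded induction.\<close>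

lemma coherent_in_subgroup:
  assumes coh: "coherent n k w"
    and base: "\<And>R. matching n R \<Longrightarrow> card R \<le> k \<Longrightarrow> \<not> overcrowded R \<Longrightarrow> \<not> overcrowded (R\<inverse>) \<Longrightarrow> w R \<in> H"
    and "matching n R" "card R \<le> k"
  shows "w R \<in> H"
  using assms(3,4)
proof (induction R rule: wf_induct_rule[OF wf_matching_order[of n]])
  case (1 R)
  consider "overcrowded R" | "overcrowded (R\<inverse>)" | "\<not> overcrowded R" "\<not> overcrowded (R\<inverse>)" by blast
  then show ?case
  proof cases
    case 1
    then show ?thesis using overcrowded_reduction[OF coh] "1.prems" "1.IH" by blast
  next
    case 2
    have "w ((R\<inverse>)\<inverse>) \<in> H"
    proof (rule overcrowded_reduction[OF coherent_converse[OF coh], where R = "R\<inverse>"])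
      fix R' assume R': "matching n R'" "card R' \<le> k" "(R', R\<inverse>) \<in> matching_order n"
      then show "w (R'\<inverse>) \<in> H"
        using "1.IH"[of "R'\<inverse>"] matching_converse[OF R'(1)] matching_order_converse[of R' "R\<inverse>"]
        by (simp add: card_inverse)
    qed (use 2 "1.prems" in \<open>auto intro: matching_converse simp: card_inverse\<close>)
    then show ?thesis by simp
  qed (use base "1.prems" in auto)
qed

end

section \<open>Inverse Schensted insertion\<close>

text \<open>
  \<open>R\<close> is read as the list of bumps of a row insertion: \<open>(x, y) \<in> R\<close> means that inserting the \<open>x\<close>-th letter
  of a permutation bumps \<open>y\<close> from the first row. The final first row consists of the values that are
  never bumped, and the insertions are undone from the last position to the first. \<open>first_row n R x\<close> is
  the first row after \<open>x\<close> insertions and \<open>removed n R x\<close> the \<open>x\<close>-th letter. The set \<open>removable n R x\<close> may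
  be empty, in which case \<open>removed n R x\<close> is a junk value; \<open>standard\<close> excludes this.
\<close>

primrec row_back :: "nat \<Rightarrow> (nat \<times> nat) set \<Rightarrow> nat \<Rightarrow> nat set" where
  "row_back n R 0 = {1..n} - snd ` R"
| "row_back n R (Suc d) =
     (row_back n R d - {Max {a \<in> row_back n R d. \<forall>y\<in>R `` {n - d}. a < y}}) \<union> R `` {n - d}"

definition first_row :: "nat \<Rightarrow> (nat \<times> nat) set \<Rightarrow> nat \<Rightarrow> nat set" where
  "first_row n R x = row_back n R (n - x)"

text \<open>A letter that bumped \<open>y\<close> is recovered as the greatest row entry below
  \<open>y\<close>. A position outside the domain of \<open>R\<close> bumped nothing, so its letter
  is the greatest entry of the row; the condition is then void. One formula covers both
  cases.\<close>

definition removable :: "nat \<Rightarrow> (nat \<times> nat) set \<Rightarrow> nat \<Rightarrow> nat set" where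
  "removable n R x = {a \<in> first_row n R x. \<forall>y\<in>R `` {x}. a < y}"

definition removed :: "nat \<Rightarrow> (nat \<times> nat) set \<Rightarrow> nat \<Rightarrow> nat" where
  "removed n R x = Max (removable n R x)"

definition standard :: "nat \<Rightarrow> (nat \<times> nat) set \<Rightarrow> bool" where
  "standard n R \<longleftrightarrow> (\<forall>x\<in>{1..n}. removable n R x \<noteq> {})"

lemma first_row_last: "first_row n R n = {1..n} - snd ` R"
  by (simp add: first_row_def)

lemma first_row_Suc:
  assumes "x < n"
  shows "first_row n R x = (first_row n R (Suc x) - {removed n R (Suc x)}) \<union> R `` {Suc x}"
proof -
  have "n - x = Suc (n - Suc x)" "n - (n - Suc x) = Suc x" using assms by auto
  then show ?thesis by (simp add: first_row_def removed_def removable_def)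
qed

context
  fixes n :: nat and R :: "(nat \<times> nat) set"
  assumes R: "matching n R"
begin

lemma Image_matching: "(x, y) \<in> R \<Longrightarrow> R `` {x} = {y}"
  using R inj_onD[of fst R "(x, y)"] by (fastforce simp: matching_def)

lemma first_row_subset:
  assumes "x \<le> n" shows "first_row n R x \<subseteq> {1..n}"
  using assms
proof (induction rule: inc_induct)
  case base
  show ?case by (auto simp: first_row_last)
next
  case (step x)
  have "R `` {Suc x} \<subseteq> {1..n}" using R by (auto simp: matching_def)
  then show ?case using step.IH unfolding first_row_Suc[OF step.hyps(2)] by blast
qed

lemma finite_first_row: "x \<le> n \<Longrightarrow> finite (first_row n R x)"
  using first_row_subset finite_subset by blast

text \<open>Going backwards, the row gains only the value bumped at the undone step, and no value of
  a matching is bumped twice.\<close>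

lemma first_row_disjoint:
  assumes "x \<le> n" shows "first_row n R x \<inter> R `` {..x} = {}"
  using assms
proof (induction rule: inc_induct)
  case base
  show ?case by (force simp: first_row_last)
next
  case (step x)
  have "R `` {Suc x} \<inter> R `` {..x} = {}"
    using R by (fastforce simp: matching_def inj_on_def)
  moreover have "R `` {..x} \<subseteq> R `` {..Suc x}" by auto
  ultimately show ?case using step.IH unfolding first_row_Suc[OF step.hyps(2)] by blast
qed

lemma removed_mem:
  assumes "x \<le> n" "removable n R x \<noteq> {}"
  shows "removed n R x \<in> removable n R x"
  unfolding removed_def
  by (rule Max_in) (use assms finite_first_row in \<open>auto simp: removable_def\<close>)

lemma le_removed:
  assumes "x \<le> n" "a \<in> removable n R x"
  shows "a \<le> removed n R x"
  unfolding removed_def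
  by (rule Max_ge) (use assms finite_first_row in \<open>auto simp: removable_def\<close>)

text \<open>A step that bumps keeps the length of the row, and a step that does not bump extends it
  by one. The bound \<open>x0\<close> makes this available before reverse insertion is known to
  succeed throughout.\<close>

lemma card_first_row:
  assumes "x0 \<le> x" "x \<le> n" and valid: "\<And>x. x0 < x \<Longrightarrow> x \<le> n \<Longrightarrow> removable n R x \<noteq> {}"
  shows "card (first_row n R x) = card ({1..x} - fst ` R)"
  using assms(2,1)
proof (induction rule: inc_induct)
  case base
  have "card (fst ` R) = card (snd ` R)" "finite R"
    using R matching_finite by (auto simp: card_image matching_def)
  moreover have "fst ` R \<subseteq> {1..n}" "snd ` R \<subseteq> {1..n}" using R by (auto simp: matching_def)
  ultimately show ?case by (simp add: first_row_last card_Diff_subset)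
next
  case (step x)
  let ?A = "first_row n R (Suc x)" and ?m = "removed n R (Suc x)"
  have IH: "card ?A = card ({1..Suc x} - fst ` R)" using step by simp
  have finA: "finite ?A" using step by (intro finite_first_row) simp
  have m: "?m \<in> ?A"
    using removed_mem[of "Suc x"] valid[of "Suc x"] step by (auto simp: removable_def)
  show ?case
  proof (cases "Suc x \<in> fst ` R")
    case True
    then obtain y where y: "(Suc x, y) \<in> R" by force
    have "y \<in> R `` {..Suc x}" using y by blast
    then have "y \<notin> ?A" using first_row_disjoint[of "Suc x"] step by auto
    moreover have "first_row n R x = insert y (?A - {?m})"
      unfolding first_row_Suc[OF step.hyps(2)] Image_matching[OF y] by blast
    moreover have "card ?A > 0" using m finA card_gt_0_iff by blast
    ultimately have "card (first_row n R x) = card ?A"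
      using m finA by simp
    moreover have "{1..Suc x} - fst ` R = {1..x} - fst ` R"
      using True by (auto simp: atLeastAtMostSuc_conv)
    ultimately show ?thesis using IH by simp
  next
    case False
    have "R `` {Suc x} = {}" using False by force
    then have "first_row n R x = ?A - {?m}" unfolding first_row_Suc[OF step.hyps(2)] by simp
    then have "card (first_row n R x) = card ?A - 1" using m by simp
    moreover have "{1..Suc x} - fst ` R = insert (Suc x) ({1..x} - fst ` R)"
      using False by (auto simp: atLeastAtMostSuc_conv)
    then have "card ({1..Suc x} - fst ` R) = Suc (card ({1..x} - fst ` R))" by simp
    ultimately show ?thesis using IH by simp
  qed
qed

text \<open>
  A scarcity of small elements in an intermediate first row is witnessed by an increasing sequence to
  its right; this invariant carries the sequence through the undoing of the insertions.
\<close>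

definition bounded_chain :: "nat \<Rightarrow> nat \<Rightarrow> nat \<Rightarrow> (nat \<times> nat) set \<Rightarrow> bool" where
  "bounded_chain x z k C \<longleftrightarrow> C \<subseteq> R \<and> chain C \<and> (\<forall>p\<in>C. x < fst p \<and> z \<le> snd p) \<and>
     (\<exists>X. x \<le> X \<and> fst ` C \<subseteq> {..X} \<and> card ({1..X} - fst ` R) \<le> k + card C
        \<or> z \<le> Suc X \<and> snd ` C \<subseteq> {..X} \<and> card ({1..X} - snd ` R) \<le> k + card C)"

lemma bounded_chain_mono:
  assumes "bounded_chain (Suc x) z k C" shows "bounded_chain x z k C"
  using assms unfolding bounded_chain_def by (meson Suc_lessD Suc_leD)

text \<open>The new point lies strictly below and to the left of \<open>C\<close>. The bounds
  \<open>x \<le> X\<close> and \<open>z \<le> Suc X\<close> stored in the invariant let the same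
  \<open>X\<close> serve for the longer chain.\<close>

lemma bounded_chain_insert:
  assumes "bounded_chain x (Suc y) k C" "(x, y) \<in> R"
  shows "chain (insert (x, y) C)" "insert (x, y) C \<subseteq> R" "card (insert (x, y) C) = Suc (card C)"
    and "\<forall>p\<in>insert (x, y) C. x \<le> fst p \<and> y \<le> snd p"
    and "\<exists>X. x \<le> X \<and> fst ` insert (x, y) C \<subseteq> {..X} \<and> card ({1..X} - fst ` R) \<le> k + card C
        \<or> y \<le> X \<and> snd ` insert (x, y) C \<subseteq> {..X} \<and> card ({1..X} - snd ` R) \<le> k + card C"
proof -
  have C: "C \<subseteq> R" "chain C" "\<forall>p\<in>C. x < fst p \<and> Suc y \<le> snd p"
    and X: "\<exists>X. x \<le> X \<and> fst ` C \<subseteq> {..X} \<and> card ({1..X} - fst ` R) \<le> k + card C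
        \<or> Suc y \<le> Suc X \<and> snd ` C \<subseteq> {..X} \<and> card ({1..X} - snd ` R) \<le> k + card C"
    using assms by (auto simp: bounded_chain_def)
  show "insert (x, y) C \<subseteq> R" using C(1) assms by simp
  show "chain (insert (x, y) C)" using C unfolding chain_def by (auto simp: Suc_le_eq) 
  have "(x, y) \<notin> C" using C(3) by auto
  moreover have "finite C" using C(1) matching_finite[OF R] finite_subset by blast
  ultimately show "card (insert (x, y) C) = Suc (card C)" by simp
  show "\<forall>p\<in>insert (x, y) C. x \<le> fst p \<and> y \<le> snd p" using C(3) by fastforce
  show "\<exists>X. x \<le> X \<and> fst ` insert (x, y) C \<subseteq> {..X} \<and> card ({1..X} - fst ` R) \<le> k + card C
        \<or> y \<le> X \<and> snd ` insert (x, y) C \<subseteq> {..X} \<and> card ({1..X} - snd ` R) \<le> k + card C"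
    using X by (elim exE) (rule exI, simp)
qed

text \<open>Induction from position \<open>n\<close> downwards. If the undone step bumped
  \<open>y\<close>, the number of entries below \<open>z\<close> drops only when
  \<open>?m < z \<le> y\<close>, and the lost entry is paid for by putting the point of this step in
  front of the chain. If it bumped nothing, \<open>?m\<close> is the end of the row, and its loss
  matters only when the whole row lies below \<open>z\<close>.\<close>

lemma bounded_chain_exists:
  assumes "x0 \<le> x" "x \<le> n" and valid: "\<And>x. x0 < x \<Longrightarrow> x \<le> n \<Longrightarrow> removable n R x \<noteq> {}"
    and "card {a \<in> first_row n R x. a < z} \<le> k"
  shows "\<exists>C. bounded_chain x z k C"
  using assms(2,1,4)
proof (induction arbitrary: z k rule: inc_induct)
  case base
  have "{a \<in> first_row n R n. a < z} = {1..z - 1} - snd ` R \<or> n < z"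
    by (auto simp: first_row_last)
  moreover have "card ({1..n} - fst ` R) = card {a \<in> first_row n R n. a < z}" if "n < z"
  proof -
    have "{a \<in> first_row n R n. a < z} = first_row n R n"
      using that first_row_subset[of n] by fastforce
    then show ?thesis using card_first_row[of n n] by simp
  qed
  ultimately have "card ({1..z - 1} - snd ` R) \<le> k \<or> card ({1..n} - fst ` R) \<le> k"
    using base by (metis (no_types, lifting))
  \<comment> \<open>For the empty chain the witness is \<open>X = z - 1\<close> for values, where
    \<open>z \<le> Suc X\<close> allows for the shift, or \<open>X = n\<close> for
    positions.\<close>
  then have "bounded_chain n z k {}"
    unfolding bounded_chain_def
    by (elim disjE) (auto simp: chain_def intro: exI[of _ "z - 1"] exI[of _ n])
  then show ?case ..
next
  case (step x)
  let ?A = "first_row n R (Suc x)" and ?m = "removed n R (Suc x)"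
  let ?B = "first_row n R x"
  have IH: "\<exists>C. bounded_chain (Suc x) z k C" if "card {a \<in> ?A. a < z} \<le> k" for z k
    using step.IH[OF _ that] step.prems by simp
  have IH': "\<exists>C. bounded_chain x z k C" if "card {a \<in> ?A. a < z} \<le> k" for z k
    using IH[OF that] bounded_chain_mono by blast
  have fin: "finite ?A" "finite ?B" using step by (auto intro!: finite_first_row)
  have ne: "removable n R (Suc x) \<noteq> {}" using valid step by simp
  have m: "?m \<in> ?A" and mR: "\<And>y. (Suc x, y) \<in> R \<Longrightarrow> ?m < y"
    using removed_mem[OF _ ne] step by (auto simp: removable_def)
  have max: "a \<le> ?m" if "a \<in> ?A" "\<And>y. (Suc x, y) \<in> R \<Longrightarrow> a < y" for a
    using le_removed[of "Suc x" a] that step by (auto simp: removable_def)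
  show ?case
  proof (cases "Suc x \<in> fst ` R")
    case False
    then have no: "(Suc x, y) \<notin> R" for y by force
    then have B: "?B = ?A - {?m}" unfolding first_row_Suc[OF step.hyps(2)] by blast
    show ?thesis
    proof (cases "?m < z")
      case True
      then have "{a \<in> ?B. a < z} = ?B" using max no B by fastforce
      then have "card ({1..x} - fst ` R) \<le> k"
        using card_first_row[of x0 x] valid step by simp
      then have "bounded_chain x z k {}" unfolding bounded_chain_def by (auto simp: chain_def)
      then show ?thesis ..
    next
      case False
      then have "{a \<in> ?B. a < z} = {a \<in> ?A. a < z}" using B by auto
      then show ?thesis using IH'[of z k] step.prems by simp
    qed
  next
    case True
    then obtain y where y: "(Suc x, y) \<in> R" by force
    have B: "?B = insert y (?A - {?m})"
      unfolding first_row_Suc[OF step.hyps(2)] Image_matching[OF y] by blast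
    have "y \<in> R `` {..Suc x}" using y by blast
    then have yA: "y \<notin> ?A" using first_row_disjoint[of "Suc x"] step by auto
    have my: "?m < y" using mR y .
    have max': "a \<le> ?m" if "a \<in> ?A" "a < y" for a
    proof (rule max[OF that(1)])
      fix y' assume "(Suc x, y') \<in> R"
      then have "y' = y" using Image_matching[OF y] by blast
      then show "a < y'" using that by simp
    qed
    consider "z \<le> ?m" | "y < z" | "?m < z" "z \<le> y" by linarith
    then show ?thesis
    proof cases
      case 1
      then have "{a \<in> ?B. a < z} = {a \<in> ?A. a < z}"
        unfolding B using my by (intro Collect_cong) auto
      then show ?thesis using IH'[of z k] step.prems by simp
    next
      case 2
      then have "{a \<in> ?B. a < z} = insert y ({a \<in> ?A. a < z} - {?m})" "?m \<in> {a \<in> ?A. a < z}"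
        using B my m by auto
      moreover from this have "card {a \<in> ?A. a < z} > 0"
        using fin by (subst card_gt_0_iff) auto
      ultimately have "card {a \<in> ?B. a < z} = card {a \<in> ?A. a < z}"
        using fin yA by simp
      then show ?thesis using IH'[of z k] step.prems by simp
    next
      case 3
      have "{a \<in> ?B. a < z} = {a \<in> ?A. a < z} - {?m}" "?m \<in> {a \<in> ?A. a < z}"
        using B m 3 by auto
      then have "card {a \<in> ?A. a < z} \<le> Suc k"
        using step.prems(2) fin by (simp add: card_Diff_singleton)
      \<comment> \<open>No entry of \<open>?A\<close> lies strictly between \<open>?m\<close> and
        \<open>y\<close>, so raising the threshold from \<open>z\<close> to \<open>Suc y\<close>
        counts nothing new, and it makes the chain start above \<open>y\<close>.\<close>
      moreover have "a < Suc y \<longleftrightarrow> a < z" if "a \<in> ?A" for a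
        using max'[OF that] 3 yA that by (cases "a = y") auto
      then have "{a \<in> ?A. a < Suc y} = {a \<in> ?A. a < z}" by blast
      ultimately obtain C where C: "bounded_chain (Suc x) (Suc y) (Suc k) C"
        using IH[of "Suc y" "Suc k"] by auto
      note ins = bounded_chain_insert[OF C y]
      have "bounded_chain x z k (insert (Suc x, y) C)"
        unfolding bounded_chain_def ins(3)
      proof (intro conjI ins(1,2))
        show "\<forall>p\<in>insert (Suc x, y) C. x < fst p \<and> z \<le> snd p"
          using ins(4) 3 by fastforce
        from ins(5) obtain X where X: "Suc x \<le> X \<and> fst ` insert (Suc x, y) C \<subseteq> {..X} \<and> card ({1..X} - fst ` R) \<le> Suc k + card C
            \<or> y \<le> X \<and> snd ` insert (Suc x, y) C \<subseteq> {..X} \<and> card ({1..X} - snd ` R) \<le> Suc k + card C" ..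
        have eq: "Suc k + card C = k + Suc (card C)" by simp
        show "\<exists>X. x \<le> X \<and> fst ` insert (Suc x, y) C \<subseteq> {..X} \<and> card ({1..X} - fst ` R) \<le> k + Suc (card C)
            \<or> z \<le> Suc X \<and> snd ` insert (Suc x, y) C \<subseteq> {..X} \<and> card ({1..X} - snd ` R) \<le> k + Suc (card C)"
          using X Suc_leD[of x X] le_SucI[OF le_trans[OF 3(2)], of X] unfolding eq by blast
      qed
      then show ?thesis ..
    qed
  qed
qed

lemma overcrowded_if_not_standard:
  assumes "\<not> standard n R"
  shows "overcrowded R \<or> overcrowded (R\<inverse>)"
proof -
  let ?P = "\<lambda>x. x \<in> {1..n} \<and> removable n R x = {}"
  define x where "x = (GREATEST x. ?P x)"
  have ex: "\<exists>x. ?P x" using assms by (auto simp: standard_def)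
  have x: "?P x" unfolding x_def using ex by (elim exE) (rule GreatestI_nat[of _ _ n], auto)
  have valid: "removable n R x' \<noteq> {}" if "x < x'" "x' \<le> n" for x'
  proof
    assume "removable n R x' = {}"
    then have "?P x'" using that by auto
    then have "x' \<le> x" unfolding x_def by (rule Greatest_le_nat[of _ _ n]) auto
    then show False using that by simp
  qed
  show ?thesis
  proof (cases "x \<in> fst ` R")
    case False
    then have "(x, y) \<notin> R" for y by force
    then have "first_row n R x = {}" using x by (auto simp: removable_def)
    then have "card ({1..x} - fst ` R) = 0" using card_first_row[of x x] valid x by simp
    then show ?thesis using x False by auto
  next
    case True
    then obtain y where y: "(x, y) \<in> R" by force
    have "y \<in> R `` {..x}" using y by blast
    then have yA: "y \<notin> first_row n R x" using first_row_disjoint[of x] x by auto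
    have "{a \<in> first_row n R x. a < y} = {}"
      using x Image_matching[OF y] by (simp add: removable_def)
    then have "{a \<in> first_row n R x. a < Suc y} = {}" using yA less_Suc_eq by auto
    then have "card {a \<in> first_row n R x. a < Suc y} \<le> 0" by simp
    from bounded_chain_exists[OF _ _ _ this, of x] valid x
    obtain C where C: "bounded_chain x (Suc y) 0 C" by auto
    note ins = bounded_chain_insert[OF C y]
    let ?C = "insert (x, y) C"
    from ins(5) obtain X where "fst ` ?C \<subseteq> {..X} \<and> card ({1..X} - fst ` R) \<le> card C
        \<or> snd ` ?C \<subseteq> {..X} \<and> card ({1..X} - snd ` R) \<le> card C" by auto
    then show ?thesis
    proof
      assume *: "snd ` ?C \<subseteq> {..X} \<and> card ({1..X} - snd ` R) \<le> card C"
      then have "overcrowded R"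
        unfolding overcrowded_def using ins(1-3) by (intro exI[of _ ?C] exI[of _ X]) simp
      then show ?thesis ..
    next
      assume *: "fst ` ?C \<subseteq> {..X} \<and> card ({1..X} - fst ` R) \<le> card C"
      have "inj_on fst ?C"
        by (rule inj_on_subset[OF _ ins(2)]) (use R in \<open>simp add: matching_def\<close>)
      moreover have "inj_on snd ?C"
        by (rule inj_on_subset[OF _ ins(2)]) (use R in \<open>simp add: matching_def\<close>)
      \<comment> \<open>Distinct points of \<open>?C\<close> differ in both components, so the order
        of their values determines the order of their positions.\<close>
      ultimately have "chain (?C\<inverse>)"
        using ins(1) unfolding chain_def inj_on_def
        by (metis (no_types, lifting) converse_iff linorder_neqE_nat order_less_imp_not_less prod.collapse prod.inject)
      moreover have "?C\<inverse> \<subseteq> R\<inverse>" using ins(2) by auto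
      moreover have "card (?C\<inverse>) = Suc (card C)" using ins(3) by (simp only: card_inverse)
      ultimately have "overcrowded (R\<inverse>)"
        unfolding overcrowded_def using * snd_converse[of R] snd_converse[of ?C]
        by (intro exI[of _ "?C\<inverse>"] exI[of _ X]) simp
      then show ?thesis ..
    qed
  qed
qed

section \<open>Recovering a partial permutation from its letters\<close>

context
  assumes std: "standard n R"
begin

lemma removed_in_first_row: "x \<in> {1..n} \<Longrightarrow> removed n R x \<in> first_row n R x"
  using removed_mem[of x] std by (auto simp: standard_def removable_def)

lemma first_row_0: "first_row n R 0 = {}"
proof -
  have "card (first_row n R 0) = 0"
    using card_first_row[of 0 0] std by (simp add: standard_def)
  then show ?thesis using finite_first_row[of 0] by simp
qed

text \<open>A removed letter could return to an earlier row only as a bumped value; but the values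
  bumped up to step \<open>x\<close> do not occur in the row after step \<open>x\<close>, from which
  the letter is taken.\<close>

lemma inj_on_removed: "inj_on (removed n R) {1..n}"
proof -
  have sub: "first_row n R x' \<subseteq> (first_row n R x - {removed n R x}) \<union> R `` {..x}"
    if "x' < x" "x \<le> n" for x x'
  proof -
    have "x' \<le> x - 1" using that by simp
    then show ?thesis
    proof (induction rule: inc_induct)
      case base
      have "R `` {Suc (x - 1)} \<subseteq> R `` {..x}" using that by auto
      then show ?case using first_row_Suc[of "x - 1" n R] that by auto
    next
      case (step z)
      have "R `` {Suc z} \<subseteq> R `` {..x}" using step by auto
      then show ?case using step first_row_Suc[of z n R] that by auto
    qed
  qed
  have ne: "removed n R x' \<noteq> removed n R x" if "x' < x" "x \<in> {1..n}" "x' \<in> {1..n}" for x x'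
  proof
    assume "removed n R x' = removed n R x"
    then have "removed n R x \<in> R `` {..x}"
      using sub[of x' x] that removed_in_first_row[of x'] by auto
    then show False
      using first_row_disjoint[of x] removed_in_first_row[of x] that by auto
  qed
  show ?thesis by (rule linorder_inj_onI') (use ne in \<open>auto dest: sym\<close>)
qed

text \<open>This is the forward insertion rule: the inserted letter bumps the least larger entry,
  and nothing if no entry is larger. It expresses \<open>R\<close> through the letters and the
  preceding rows.\<close>

lemma Image_eq_removed:
  assumes "x < n"
  shows "R `` {Suc x} = {y \<in> first_row n R x. removed n R (Suc x) < y \<and>
     (\<forall>a\<in>first_row n R x. removed n R (Suc x) < a \<longrightarrow> y \<le> a)}" (is "_ = ?Y")
proof -
  let ?A = "first_row n R (Suc x)" and ?m = "removed n R (Suc x)"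
  have ne: "removable n R (Suc x) \<noteq> {}" using std assms by (simp add: standard_def)
  have mR: "?m < y" if "(Suc x, y) \<in> R" for y
    using removed_mem[OF _ ne] assms that by (auto simp: removable_def)
  have max: "a \<le> ?m" if "a \<in> ?A" "\<And>y. (Suc x, y) \<in> R \<Longrightarrow> a < y" for a
    using le_removed[of "Suc x" a] that assms by (auto simp: removable_def)
  note B = first_row_Suc[OF assms, of R]
  show ?thesis
  proof (cases "\<exists>y. (Suc x, y) \<in> R")
    case True
    then obtain y where y: "(Suc x, y) \<in> R" by blast
    have im: "R `` {Suc x} = {y}" using Image_matching[OF y] .
    have "y \<le> a" if "a \<in> first_row n R x" "?m < a" for a
    proof (rule ccontr)
      assume less: "\<not> y \<le> a"
      have "a \<le> ?m"
      proof (rule max)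
        show "a \<in> ?A" using that(1) less unfolding B im by auto
        fix y' assume "(Suc x, y') \<in> R"
        then have "y' = y" using im by blast
        then show "a < y'" using less by simp
      qed
      then show False using that(2) by simp
    qed
    moreover have "y \<in> first_row n R x" unfolding B im by simp
    ultimately have "?Y = {y}" using mR[OF y] by (auto intro: antisym)
    then show ?thesis using im by simp
  next
    case False
    then have "R `` {Suc x} = {}" by blast
    moreover have "?Y = {}" using max False unfolding B \<open>R `` {Suc x} = {}\<close> by force
    ultimately show ?thesis by simp
  qed
qed

lemma first_row_Suc_removed:
  assumes "x < n"
  shows "first_row n R (Suc x) = insert (removed n R (Suc x)) (first_row n R x - R `` {Suc x})"
proof -
  have "R `` {Suc x} \<subseteq> R `` {..Suc x}" by auto
  then have "first_row n R (Suc x) \<inter> R `` {Suc x} = {}"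
    using first_row_disjoint[of "Suc x"] assms by auto
  then show ?thesis
    using removed_in_first_row[of "Suc x"] assms unfolding first_row_Suc[OF assms] by auto
qed

lemma removed_permutes: "(\<lambda>x. if x \<in> {1..n} then removed n R x else x) permutes {1..n}"
proof (rule bij_imp_permutes)
  have "removed n R ` {1..n} \<subseteq> {1..n}"
    using removed_in_first_row first_row_subset by fastforce
  then have "removed n R ` {1..n} = {1..n}"
    using inj_on_removed by (intro endo_inj_surj) auto
  then have "bij_betw (removed n R) {1..n} {1..n}"
    using inj_on_removed by (simp add: bij_betw_def)
  then show "bij_betw (\<lambda>x. if x \<in> {1..n} then removed n R x else x) {1..n} {1..n}"
    by (rule bij_betw_cong[THEN iffD1, rotated]) simp
qed auto

end

end

text \<open>Forward insertion replays the letters from the empty row \<open>first_row n R 0\<close>,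
  so rows and bumps are reconstructed position by position.\<close>

lemma standard_eqI:
  assumes R: "matching n R" "standard n R" and R': "matching n R'" "standard n R'"
    and eq: "\<And>x. x \<in> {1..n} \<Longrightarrow> removed n R x = removed n R' x"
  shows "R = R'"
proof -
  have row: "first_row n R x = first_row n R' x" if "x \<le> n" for x
    using that
  proof (induction x)
    case 0
    show ?case using first_row_0[OF R] first_row_0[OF R'] by simp
  next
    case (Suc x)
    then have x: "x < n" and IH: "first_row n R x = first_row n R' x" by auto
    have "removed n R (Suc x) = removed n R' (Suc x)" using eq x by simp
    then show ?case
      unfolding first_row_Suc_removed[OF R x] first_row_Suc_removed[OF R' x]
        Image_eq_removed[OF R x] Image_eq_removed[OF R' x] IH by simp
  qed
  have im: "R `` {x} = R' `` {x}" if x: "x \<in> {1..n}" for x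
  proof -
    obtain x' where x': "x = Suc x'" "x' < n" using x by (cases x) auto
    show ?thesis using eq[OF x] row[of x'] x'
      unfolding x'(1) Image_eq_removed[OF R x'(2)] Image_eq_removed[OF R' x'(2)] by simp
  qed
  have "fst ` R \<subseteq> {1..n}" "fst ` R' \<subseteq> {1..n}" using R(1) R'(1) by (auto simp: matching_def)
  then have "(x, y) \<in> R \<longleftrightarrow> (x, y) \<in> R'" for x y using im by (metis Image_singleton_iff fst_conv imageI subsetD)
  then show ?thesis by auto
qed

lemma card_standard_le_fact: "card {R. matching n R \<and> standard n R} \<le> fact n"
proof -
  let ?p = "\<lambda>R x. if x \<in> {1..n} then removed n R x else x"
  have "inj_on ?p {R. matching n R \<and> standard n R}"
  proof (rule inj_onI)
    fix R R' assume *: "R \<in> {R. matching n R \<and> standard n R}" "R' \<in> {R. matching n R \<and> standard n R}"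
      and eq: "?p R = ?p R'"
    show "R = R'"
    proof (rule standard_eqI)
      fix x assume "x \<in> {1..n}"
      then show "removed n R x = removed n R' x" using fun_cong[OF eq, of x] by simp
    qed (use * in auto)
  qed
  moreover have "?p ` {R. matching n R \<and> standard n R} \<subseteq> {\<sigma>. \<sigma> permutes {1..n}}"
    using removed_permutes by blast
  ultimately have "card {R. matching n R \<and> standard n R} \<le> card {\<sigma>. \<sigma> permutes {1..n}}"
    by (intro card_inj_on_le finite_permutations) auto
  then show ?thesis by (simp add: card_permutations)
qed

section \<open>Coherent functions come from functions on the symmetric group\<close>

text \<open>Since \<open>card J \<le> card I\<close>, both matrices can be padded by zeros to square
  ones of size \<open>card I\<close> over the rationals, where a one-sided inverse is
  two-sided.\<close>

lemma left_inverse_imp_right_inverse: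
  fixes X :: "'i \<Rightarrow> 'j \<Rightarrow> int" and A :: "'j \<Rightarrow> 'i \<Rightarrow> int"
  assumes "finite I" "finite J" "card J \<le> card I"
    and left: "\<And>i i'. i \<in> I \<Longrightarrow> i' \<in> I \<Longrightarrow> (\<Sum>j\<in>J. X i j * A j i') = of_bool (i = i')"
    and "j \<in> J" "j' \<in> J"
  shows "(\<Sum>i\<in>I. A j i * X i j') = of_bool (j = j')"
proof -
  let ?N = "card I" and ?m = "card J"
  obtain f where f: "bij_betw f {0..<?N} I" using ex_bij_betw_nat_finite[OF assms(1)] by blast
  obtain g where g: "bij_betw g {0..<?m} J" using ex_bij_betw_nat_finite[OF assms(2)] by blast
  define Y where "Y = mat ?N ?N (\<lambda>(a, b). if b < ?m then rat_of_int (X (f a) (g b)) else 0)"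
  define B where "B = mat ?N ?N (\<lambda>(b, c). if b < ?m then rat_of_int (A (g b) (f c)) else 0)"
  have YB: "Y \<in> carrier_mat ?N ?N" "B \<in> carrier_mat ?N ?N" by (auto simp: Y_def B_def)
  have fI: "f a \<in> I" if "a < ?N" for a using f that by (auto simp: bij_betw_def)
  have finj: "f a = f a' \<longleftrightarrow> a = a'" if "a < ?N" "a' < ?N" for a a'
    using f that by (auto simp: bij_betw_def inj_on_def)
  have "Y * B = 1\<^sub>m ?N"
  proof (rule eq_matI)
    fix a c assume "a < dim_row (1\<^sub>m ?N)" "c < dim_col (1\<^sub>m ?N)"
    then have ac: "a < ?N" "c < ?N" by auto
    then have "(Y * B) $$ (a, c) = (\<Sum>b = 0..<?N. (if b < ?m then rat_of_int (X (f a) (g b) * A (g b) (f c)) else 0))"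
      by (auto simp: Y_def B_def scalar_prod_def intro!: sum.cong)
    also have "\<dots> = (\<Sum>b = 0..<?m. rat_of_int (X (f a) (g b) * A (g b) (f c)))"
      using assms(3) by (intro sum.mono_neutral_cong_right) auto
    also have "\<dots> = rat_of_int (\<Sum>j\<in>J. X (f a) j * A j (f c))"
      by (simp add: sum.reindex_bij_betw[OF g, symmetric])
    also have "\<dots> = 1\<^sub>m ?N $$ (a, c)" using left fI finj ac by simp
    finally show "(Y * B) $$ (a, c) = 1\<^sub>m ?N $$ (a, c)" .
  qed (auto simp: Y_def B_def)
  then have BY: "B * Y = 1\<^sub>m ?N" by (rule mat_mult_left_right_inverse[OF YB])
  have "j \<in> g ` {0..<?m}" "j' \<in> g ` {0..<?m}" using g assms(5,6) by (auto simp: bij_betw_def)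
  then obtain b b' where b: "b < ?m" "j = g b" "b' < ?m" "j' = g b'"
    by (elim imageE) auto
  have "rat_of_int (\<Sum>i\<in>I. A j i * X i j') = (\<Sum>c = 0..<?N. rat_of_int (A j (f c) * X (f c) j'))"
    by (simp add: sum.reindex_bij_betw[OF f, symmetric])
  also have "\<dots> = (B * Y) $$ (b, b')"
    using b assms(3) by (auto simp: Y_def B_def scalar_prod_def intro!: sum.cong)
  also have "\<dots> = of_bool (b = b')" using BY b assms(3) by simp
  also have "b = b' \<longleftrightarrow> j = j'" using b g by (auto simp: bij_betw_def inj_on_def)
  finally have "rat_of_int (\<Sum>i\<in>I. A j i * X i j') = rat_of_int (of_bool (j = j'))" by simp
  then show ?thesis by (simp only: of_int_eq_iff)
qed

text \<open>The coefficients need not have a unit distinct from \<open>0\<close>, so \<open>of_int\<close> is not available for them.\<close>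

definition int_scale :: "int \<Rightarrow> 'a::ab_group_add \<Rightarrow> 'a" where
  "int_scale k a = (\<Sum>i<nat k. a) - (\<Sum>i<nat (- k). a)"

lemma int_scale_0: "int_scale 0 a = 0" and int_scale_1: "int_scale 1 a = a"
  by (simp_all add: int_scale_def)

text \<open>The result is independent of how an integer is written as a difference; additivity
  follows from this without distinguishing signs.\<close>

lemma int_scale_diff: "int_scale (int p - int q) a = (\<Sum>i<p. a) - (\<Sum>i<q. a)"
proof -
  have add: "(\<Sum>i<m + l. a) = (\<Sum>i<m. a) + (\<Sum>i<l. a)" for m l :: nat
    by (induction l) (auto simp: algebra_simps)
  have nat: "nat (int p - int q) = p - q" "nat (int q - int p) = q - p" by auto
  show ?thesis
  proof (cases "p \<le> q")
    case True
    then show ?thesis using add[of p "q - p"] by (simp add: int_scale_def nat algebra_simps)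
  next
    case False
    then show ?thesis using add[of q "p - q"] by (simp add: int_scale_def nat algebra_simps)
  qed
qed

lemma int_scale_add: "int_scale (k + l) a = int_scale k a + int_scale l a"
proof -
  have add: "(\<Sum>i<m + l. a) = (\<Sum>i<m. a) + (\<Sum>i<l. a)" for m l :: nat
    by (induction l) (auto simp: algebra_simps)
  obtain p q p' q' where "k = int p - int q" "l = int p' - int q'" using int_diff_cases by metis
  moreover have "int_scale (int p - int q + (int p' - int q')) a = int_scale (int (p + p') - int (q + q')) a"
    by (simp add: algebra_simps)
  ultimately show ?thesis by (simp only: int_scale_diff add) (simp add: algebra_simps)
qed

lemma int_scale_sum: "int_scale (\<Sum>i\<in>I. k i) a = (\<Sum>i\<in>I. int_scale (k i) a)"
  by (induction I rule: infinite_finite_induct) (auto simp: int_scale_0 int_scale_add)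

section \<open>Sums over the permutations extending a partial permutation\<close>

definition extensions :: "nat \<Rightarrow> (nat \<times> nat) set \<Rightarrow> (nat \<Rightarrow> nat) set" where
  "extensions n R = {\<sigma>. \<sigma> permutes {1..n} \<and> (\<forall>p\<in>R. \<sigma> (fst p) = snd p)}"

lemma finite_extensions: "finite (extensions n R)"
  by (rule finite_subset[OF _ finite_permutations[of "{1..n}"]]) (auto simp: extensions_def)

text \<open>A permutation extending \<open>R\<close> sends the free position \<open>x\<close> to
  exactly one free value, and takes the free value \<open>y\<close> at exactly one free position, so
  the extensions of \<open>R\<close> split into disjoint unions.\<close>

lemma coherent_extensions: "coherent n k (\<lambda>R. \<Sum>\<sigma>\<in>extensions n R. c \<sigma>)"
  unfolding coherent_def
proof (intro allI impI conjI ballI)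
  fix R x assume R: "matching n R \<and> card R < k" and x: "x \<in> {1..n} - fst ` R"
  have "extensions n R = (\<Union>y\<in>{1..n} - snd ` R. extensions n (insert (x, y) R))"
  proof (intro equalityI subsetI)
    fix \<sigma> assume s: "\<sigma> \<in> extensions n R"
    then have "\<sigma> x \<in> {1..n}" using x permutes_in_image[of \<sigma> "{1..n}" x] by (auto simp: extensions_def)
    moreover have "\<sigma> x \<notin> snd ` R"
    proof
      assume "\<sigma> x \<in> snd ` R"
      then obtain p where p: "p \<in> R" "\<sigma> x = snd p" by auto
      then have "\<sigma> x = \<sigma> (fst p)" using s by (simp add: extensions_def)
      then have "x = fst p" using s permutes_inj[of \<sigma> "{1..n}"] by (auto simp: extensions_def inj_def)
      then show False using p x by simp
    qed
    ultimately show "\<sigma> \<in> (\<Union>y\<in>{1..n} - snd ` R. extensions n (insert (x, y) R))"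
      using s by (auto simp: extensions_def)
  qed (auto simp: extensions_def)
  moreover have "\<forall>y\<in>{1..n} - snd ` R. \<forall>y'\<in>{1..n} - snd ` R. y \<noteq> y' \<longrightarrow>
      extensions n (insert (x, y) R) \<inter> extensions n (insert (x, y') R) = {}"
    by (auto simp: extensions_def)
  ultimately show "(\<Sum>\<sigma>\<in>extensions n R. c \<sigma>)
      = (\<Sum>y\<in>{1..n} - snd ` R. \<Sum>\<sigma>\<in>extensions n (insert (x, y) R). c \<sigma>)"
    by (simp only:) (rule sum.UNION_disjoint; simp add: finite_extensions)
next
  fix R y assume R: "matching n R \<and> card R < k" and y: "y \<in> {1..n} - snd ` R"
  have "extensions n R = (\<Union>x\<in>{1..n} - fst ` R. extensions n (insert (x, y) R))"
  proof (intro equalityI subsetI)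
    fix \<sigma> assume s: "\<sigma> \<in> extensions n R"
    then have p: "\<sigma> permutes {1..n}" by (simp add: extensions_def)
    have "inv_into UNIV \<sigma> y \<in> {1..n}" using y permutes_in_image[OF permutes_inv[OF p]] by auto
    moreover have sy: "\<sigma> (inv_into UNIV \<sigma> y) = y" using permutes_inverses(1)[OF p] .
    moreover have "inv_into UNIV \<sigma> y \<notin> fst ` R"
      using s y sy by (force simp: extensions_def)
    ultimately show "\<sigma> \<in> (\<Union>x\<in>{1..n} - fst ` R. extensions n (insert (x, y) R))"
      using s by (auto simp: extensions_def)
  qed (auto simp: extensions_def)
  moreover have "x = x'" if "\<sigma> \<in> extensions n (insert (x, y) R)" "\<sigma> \<in> extensions n (insert (x', y) R)" for \<sigma> x x'
    using that permutes_inj[of \<sigma> "{1..n}"] by (auto simp: extensions_def inj_def)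
  then have "\<forall>x\<in>{1..n} - fst ` R. \<forall>x'\<in>{1..n} - fst ` R. x \<noteq> x' \<longrightarrow>
      extensions n (insert (x, y) R) \<inter> extensions n (insert (x', y) R) = {}" by blast
  ultimately show "(\<Sum>\<sigma>\<in>extensions n R. c \<sigma>)
      = (\<Sum>x\<in>{1..n} - fst ` R. \<Sum>\<sigma>\<in>extensions n (insert (x, y) R). c \<sigma>)"
    by (simp only:) (rule sum.UNION_disjoint; simp add: finite_extensions)
qed

lemma coherent_diff:
  assumes "coherent n k v" "coherent n k w" shows "coherent n k (\<lambda>R. v R - w R)"
  using assms unfolding coherent_def by (simp add: sum_subtractf)

lemma matching_graph:
  assumes "\<sigma> permutes {1..n}" shows "matching n ((\<lambda>x. (x, \<sigma> x)) ` {1..n})"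
  using permutes_in_image[OF assms] permutes_inj[OF assms]
  by (auto simp: matching_def inj_on_def inj_def)

lemma card_graph: "card ((\<lambda>x. (x, \<sigma> x)) ` {1..n}) = n"
  by (subst card_image) (auto simp: inj_on_def)

lemma extensions_graph:
  assumes "\<sigma> permutes {1..n}" shows "extensions n ((\<lambda>x. (x, \<sigma> x)) ` {1..n}) = {\<sigma>}"
proof (intro equalityI subsetI)
  fix \<tau> assume "\<tau> \<in> extensions n ((\<lambda>x. (x, \<sigma> x)) ` {1..n})"
  then have t: "\<tau> permutes {1..n}" "\<And>x. x \<in> {1..n} \<Longrightarrow> \<tau> x = \<sigma> x" by (auto simp: extensions_def)
  have "\<tau> x = \<sigma> x" for x
    using t(2) permutes_not_in[OF t(1)] permutes_not_in[OF assms] by (cases "x \<in> {1..n}") auto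
  then show "\<tau> \<in> {\<sigma>}" by auto
qed (use assms in \<open>auto simp: extensions_def\<close>)

abbreviation standard_matchings :: "nat \<Rightarrow> (nat \<times> nat) set set" where
  "standard_matchings n \<equiv> {R. matching n R \<and> standard n R}"

lemma finite_standard_matchings: "finite (standard_matchings n)"
  by (rule finite_subset[OF _ finite_matchings]) auto

text \<open>The graph of \<open>\<sigma>\<close> has \<open>\<sigma>\<close> as its only extension.
  Rewriting the function-valued coherent \<open>w\<close> at this graph, with the span of the
  indicators of standard matchings as the subgroup, yields the coefficients.\<close>

lemma permutation_indicator_in_span:
  assumes "\<sigma> permutes {1..n}"
  shows "\<exists>X :: _ \<Rightarrow> int. \<forall>\<tau>. \<tau> permutes {1..n} \<longrightarrow>
    (\<Sum>S\<in>standard_matchings n. X S * of_bool (\<tau> \<in> extensions n S)) = of_bool (\<sigma> = \<tau>)"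
proof -
  define H :: "((nat \<Rightarrow> nat) \<Rightarrow> int) set" where
    "H = range (\<lambda>X \<tau>. \<Sum>S\<in>standard_matchings n. X S * of_bool (\<tau> \<in> extensions n S))"
  define w :: "(nat \<times> nat) set \<Rightarrow> (nat \<Rightarrow> nat) \<Rightarrow> int" where
    "w = (\<lambda>R. \<Sum>\<sigma>\<in>extensions n R. (\<lambda>\<tau>. of_bool (\<sigma> = \<tau>)))"
  have w: "w R \<tau> = of_bool (\<tau> \<in> extensions n R)" for R \<tau>
  proof -
    have "w R \<tau> = (\<Sum>\<sigma>\<in>extensions n R. of_bool (\<sigma> = \<tau>))"
      unfolding w_def using finite_extensions[of n R]
      by (induction rule: finite_induct) (auto simp: zero_fun_def plus_fun_def)
    then show ?thesis using finite_extensions[of n R] by (simp add: sum.delta of_bool_def)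
  qed
  interpret add_subgroup H
  proof
    show "0 \<in> H" unfolding H_def by (rule image_eqI[of _ _ "\<lambda>_. 0"]) (auto simp: zero_fun_def)
    fix a b assume "a \<in> H" "b \<in> H"
    then obtain X Y where
      ab: "a = (\<lambda>\<tau>. \<Sum>S\<in>standard_matchings n. X S * of_bool (\<tau> \<in> extensions n S))"
      "b = (\<lambda>\<tau>. \<Sum>S\<in>standard_matchings n. Y S * of_bool (\<tau> \<in> extensions n S))"
      unfolding H_def by blast
    show "a - b \<in> H" unfolding H_def
      by (rule image_eqI[of _ _ "\<lambda>S. X S - Y S"])
        (simp_all add: ab fun_eq_iff sum_subtractf left_diff_distrib)
  qed
  have "w ((\<lambda>x. (x, \<sigma> x)) ` {1..n}) \<in> H"
  proof (rule coherent_in_subgroup[where k = n])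
    show "coherent n n w" unfolding w_def by (rule coherent_extensions)
    fix R assume R: "matching n R" "\<not> overcrowded R" "\<not> overcrowded (R\<inverse>)"
    then have "R \<in> standard_matchings n" using overcrowded_if_not_standard by blast
    have "w R \<tau> = (\<Sum>S\<in>standard_matchings n. of_bool (S = R) * of_bool (\<tau> \<in> extensions n S))" for \<tau>
    proof -
      have "(\<Sum>S\<in>standard_matchings n. of_bool (S = R) * of_bool (\<tau> \<in> extensions n S))
          = (\<Sum>S\<in>standard_matchings n. if S = R then of_bool (\<tau> \<in> extensions n R) else (0::int))"
        by (intro sum.cong) auto
      then show ?thesis
        using finite_standard_matchings[of n] \<open>R \<in> standard_matchings n\<close> by (simp add: w)
    qed
    then show "w R \<in> H" unfolding H_def by (intro image_eqI[of _ _ "\<lambda>S. of_bool (S = R)"]) auto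
  qed (use matching_graph[OF assms] card_graph[of \<sigma> n] in simp_all)
  then obtain X where
    X: "w ((\<lambda>x. (x, \<sigma> x)) ` {1..n}) = (\<lambda>\<tau>. \<Sum>S\<in>standard_matchings n. X S * of_bool (\<tau> \<in> extensions n S))"
    unfolding H_def by blast
  have "(\<Sum>S\<in>standard_matchings n. X S * of_bool (\<tau> \<in> extensions n S)) = of_bool (\<sigma> = \<tau>)" for \<tau>
    using fun_cong[OF X, of \<tau>] unfolding w extensions_graph[OF assms] by auto
  then show ?thesis by blast
qed

text \<open>The rows \<open>X \<sigma>\<close> invert the incidence matrix of standard matchings
  against permutations from one side, and by the bound \<open>n!\<close> from the other side too.
  Hence \<open>c\<close> can be chosen with prescribed sums over the extensions of the standard
  matchings. The difference to \<open>w\<close> vanishes on those of size at most \<open>k\<close>,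
  and by rewriting on all matchings of size at most \<open>k\<close>.\<close>

theorem coherent_eq_sum_extensions:
  assumes "coherent n k w"
  shows "\<exists>c. \<forall>R. matching n R \<longrightarrow> card R \<le> k \<longrightarrow> w R = (\<Sum>\<sigma>\<in>extensions n R. c \<sigma>)"
proof -
  let ?P = "{\<sigma>. \<sigma> permutes {1..n}}"
  have "\<forall>\<sigma>\<in>?P. \<exists>X :: _ \<Rightarrow> int. \<forall>\<tau>. \<tau> \<in> ?P \<longrightarrow>
      (\<Sum>S\<in>standard_matchings n. X S * of_bool (\<tau> \<in> extensions n S)) = of_bool (\<sigma> = \<tau>)"
    using permutation_indicator_in_span[of _ n] by blast
  from bchoice[OF this] obtain X :: "_ \<Rightarrow> _ \<Rightarrow> int" where
    X: "\<And>\<sigma> \<tau>. \<sigma> \<in> ?P \<Longrightarrow> \<tau> \<in> ?P \<Longrightarrow>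
      (\<Sum>S\<in>standard_matchings n. X \<sigma> S * of_bool (\<tau> \<in> extensions n S)) = of_bool (\<sigma> = \<tau>)"
    by blast
  have finP: "finite ?P" by (intro finite_permutations) simp
  have inv: "(\<Sum>\<sigma>\<in>?P. of_bool (\<sigma> \<in> extensions n S) * X \<sigma> S') = of_bool (S = S')"
    if "S \<in> standard_matchings n" "S' \<in> standard_matchings n" for S S'
    by (rule left_inverse_imp_right_inverse[where J = "standard_matchings n"])
      (use that X finP finite_standard_matchings card_standard_le_fact in
        \<open>auto simp: card_permutations\<close>)
  have inv': "(\<Sum>\<sigma>\<in>extensions n S. X \<sigma> S') = of_bool (S = S')"
    if "S \<in> standard_matchings n" "S' \<in> standard_matchings n" for S S'
  proof -
    have "(\<Sum>\<sigma>\<in>extensions n S. X \<sigma> S') = (\<Sum>\<sigma>\<in>?P. of_bool (\<sigma> \<in> extensions n S) * X \<sigma> S')"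
      using finP by (intro sum.mono_neutral_cong_left) (auto simp: extensions_def)
    then show ?thesis using inv[OF that] by simp
  qed
  \<comment> \<open>Beyond size \<open>k\<close> coherence says nothing about \<open>w\<close>, so
    the prescribed value there is set to \<open>0\<close>.\<close>
  define w' where "w' S = (if card S \<le> k then w S else 0)" for S
  define c where "c \<sigma> = (\<Sum>S\<in>standard_matchings n. int_scale (X \<sigma> S) (w' S))" for \<sigma>
  have c: "(\<Sum>\<sigma>\<in>extensions n S. c \<sigma>) = w' S" if S: "S \<in> standard_matchings n" for S
  proof -
    have "(\<Sum>\<sigma>\<in>extensions n S. c \<sigma>) = (\<Sum>S'\<in>standard_matchings n. int_scale (\<Sum>\<sigma>\<in>extensions n S. X \<sigma> S') (w' S'))"
      unfolding c_def int_scale_sum by (rule sum.swap)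
    also have "\<dots> = (\<Sum>S'\<in>standard_matchings n. if S = S' then w' S' else 0)"
      using inv'[OF S] by (intro sum.cong) (auto simp: int_scale_0 int_scale_1)
    also have "\<dots> = w' S" using S finite_standard_matchings[of n] by simp
    finally show ?thesis .
  qed
  let ?v = "\<lambda>R. w R - (\<Sum>\<sigma>\<in>extensions n R. c \<sigma>)"
  interpret add_subgroup "{0 :: 'a}" by standard auto
  have "?v R \<in> {0}" if "matching n R" "card R \<le> k" for R
  proof (rule coherent_in_subgroup[OF _ _ that])
    show "coherent n k ?v" using assms coherent_extensions by (rule coherent_diff)
    fix R assume R: "matching n R" "card R \<le> k" "\<not> overcrowded R" "\<not> overcrowded (R\<inverse>)"
    then have "R \<in> standard_matchings n" using overcrowded_if_not_standard by blast
    then show "?v R \<in> {0}" using c R(2) by (simp add: w'_def)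
  qed
  then show ?thesis by (intro exI[of _ c]) simp
qed

section \<open>Matrices commuting with diagrams\<close>

text \<open>
  A diagram is given by labellings \<open>p\<close> and \<open>q\<close> of its top and bottom vertices, whose fibres are the
  blocks. The set \<open>Z\<close> of positions pinned to the value \<open>n\<close> is empty for \<open>P\<^sub>r\<close> and \<open>{r + 1}\<close> for the half
  partition algebra, so that one argument covers both.
\<close>

definition compatible ::
    "nat set \<Rightarrow> (nat \<Rightarrow> nat) \<Rightarrow> (nat \<Rightarrow> nat) \<Rightarrow> (nat \<Rightarrow> nat) \<Rightarrow> (nat \<Rightarrow> nat) \<Rightarrow> bool" where
  "compatible K p q i j \<longleftrightarrow> (\<forall>a\<in>K. \<forall>b\<in>K. (p a = p b \<longrightarrow> i a = i b) \<and> (p a = q b \<longrightarrow> i a = j b) \<and> (q a = q b \<longrightarrow> j a = j b))"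

lemma
  assumes "compatible K p q i j" "a \<in> K" "b \<in> K"
  shows compatible_top: "p a = p b \<Longrightarrow> i a = i b"
    and compatible_top_bottom: "p a = q b \<Longrightarrow> i a = j b"
    and compatible_bottom: "q a = q b \<Longrightarrow> j a = j b"
  using assms unfolding compatible_def by blast+

lemma compatible_swap: "compatible K q p j i \<longleftrightarrow> compatible K p q i j"
proof -
  have "compatible K q p j i" if c: "compatible K p q i j" for p q i j
    unfolding compatible_def
  proof (intro ballI conjI impI)
    fix a b assume ab: "a \<in> K" "b \<in> K"
    show "j a = j b" if "q a = q b" using compatible_bottom[OF c ab that] .
    show "j a = i b" if "q a = p b" using compatible_top_bottom[OF c ab(2,1)] that by simp
    show "i a = i b" if "p a = p b" using compatible_top[OF c ab that] .
  qed
  then show ?thesis by blast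
qed

definition pinned_index :: "nat set \<Rightarrow> nat set \<Rightarrow> nat \<Rightarrow> (nat \<Rightarrow> nat) set" where
  "pinned_index K Z n = {i \<in> K \<rightarrow>\<^sub>E {1..n}. \<forall>z\<in>Z. i z = n}"

text \<open>The column index comes first: \<open>\<phi> i j\<close> will be the coefficient of the
  basis vector \<open>i\<close> in the image of \<open>j\<close>, and a permutation carrying
  \<open>j\<close> to \<open>i\<close> extends this graph.\<close>

definition index_graph :: "nat set \<Rightarrow> (nat \<Rightarrow> nat) \<Rightarrow> (nat \<Rightarrow> nat) \<Rightarrow> (nat \<times> nat) set" where
  "index_graph K i j = (\<lambda>k. (j k, i k)) ` K"

text \<open>\<open>comm\<close> compares the \<open>(t, j)\<close> entries of the two products of
  \<open>\<phi>\<close> with the matrix of a diagram. The condition \<open>p z = q z\<close> puts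
  \<open>z\<close> and its primed copy into one block, as the half partition algebra
  demands.\<close>

locale invariant_kernel =
  fixes K Z :: "nat set" and n :: nat and \<phi> :: "(nat \<Rightarrow> nat) \<Rightarrow> (nat \<Rightarrow> nat) \<Rightarrow> 'b::ab_group_add"
  assumes finite_K: "finite K" and Z: "Z \<subseteq> K"
    and comm: "\<And>p q t j. \<lbrakk>\<And>z. z \<in> Z \<Longrightarrow> p z = q z; t \<in> pinned_index K Z n; j \<in> pinned_index K Z n\<rbrakk> \<Longrightarrow>
      (\<Sum>i | i \<in> pinned_index K Z n \<and> compatible K p q i j. \<phi> t i)
      = (\<Sum>l | l \<in> pinned_index K Z n \<and> compatible K p q t l. \<phi> l j)"

text \<open>Turning a diagram upside down exchanges \<open>p\<close> and \<open>q\<close> and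
  respects the condition on \<open>Z\<close>, so each result on \<open>\<phi>\<close> has a dual
  with rows and columns exchanged.\<close>

lemma (in invariant_kernel) transpose: "invariant_kernel K Z n (\<lambda>i j. \<phi> j i)"
proof
  fix p q :: "nat \<Rightarrow> nat" and t j
  assume *: "\<And>z. z \<in> Z \<Longrightarrow> p z = q z" "t \<in> pinned_index K Z n" "j \<in> pinned_index K Z n"
  show "(\<Sum>i | i \<in> pinned_index K Z n \<and> compatible K p q i j. \<phi> i t)
      = (\<Sum>l | l \<in> pinned_index K Z n \<and> compatible K p q t l. \<phi> j l)"
    using comm[of q p j t] * by (simp add: compatible_swap[of K p q])
qed (use finite_K Z in auto)

context invariant_kernel
begin

abbreviation "I \<equiv> pinned_index K Z n"

lemma finite_I: "finite I"
  by (rule finite_subset[of _ "K \<rightarrow>\<^sub>E {1..n}"]) (auto simp: pinned_index_def finite_K intro: finite_PiE)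

lemma index_eqI:
  assumes "i \<in> I" "j \<in> I" "\<And>k. k \<in> K \<Longrightarrow> i k = j k" shows "i = j"
  using assms unfolding pinned_index_def by (auto intro: PiE_ext)

text \<open>The merged diagram acts as the projection onto the indices that agree at
  \<open>a\<close> and \<open>b\<close>, so commuting with it forces both conditions to coincide at
  a nonzero entry.\<close>

lemma same_kernel:
  assumes "t \<in> I" "j \<in> I" "\<phi> t j \<noteq> 0" "a \<in> K" "b \<in> K"
  shows "t a = t b \<longleftrightarrow> j a = j b"
proof -
  \<comment> \<open>the identity diagram with the columns \<open>a\<close> and \<open>b\<close> merged\<close>
  let ?p = "\<lambda>k. if k = b then a else k"
  have c: "compatible K ?p ?p i l \<longleftrightarrow> i = l \<and> i a = i b" if "i \<in> I" "l \<in> I" for i l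
  proof
    assume c: "compatible K ?p ?p i l"
    have "i = l" by (rule index_eqI[OF that]) (use compatible_top_bottom[OF c] in simp)
    moreover have "i a = i b" using compatible_top[OF c assms(4,5)] by simp
    ultimately show "i = l \<and> i a = i b" ..
  qed (auto simp: compatible_def split: if_splits)
  have "(\<Sum>i | i \<in> I \<and> compatible K ?p ?p i j. \<phi> t i) = (\<Sum>i | i = j \<and> j a = j b. \<phi> t i)"
    by (rule sum.cong) (use c assms in auto)
  moreover have "(\<Sum>l | l \<in> I \<and> compatible K ?p ?p t l. \<phi> l j) = (\<Sum>l | l = t \<and> t a = t b. \<phi> l j)"
    by (rule sum.cong) (use c assms in auto)
  ultimately have "(\<Sum>i | i = j \<and> j a = j b. \<phi> t i) = (\<Sum>l | l = t \<and> t a = t b. \<phi> l j)"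
    using comm[of ?p ?p t j] assms by simp
  then show ?thesis using assms(3) by (cases "t a = t b"; cases "j a = j b") auto
qed

lemma compose_in_I:
  assumes "j \<in> I" "\<theta> \<in> K \<rightarrow> K" "\<And>z. z \<in> Z \<Longrightarrow> \<theta> z = z"
  shows "compose K j \<theta> \<in> I"
  using assms Z unfolding pinned_index_def compose_def by fastforce

text \<open>Joining each top vertex \<open>k\<close> to the bottom vertex \<open>\<theta> k\<close>
  gives a diagram that sends the basis vector of \<open>j\<close> to that of
  \<open>compose K j \<theta>\<close>.\<close>

lemma push_forward:
  assumes "t \<in> I" "j \<in> I" and \<theta>: "\<theta> \<in> K \<rightarrow> K" "\<And>z. z \<in> Z \<Longrightarrow> \<theta> z = z"
  shows "\<phi> t (compose K j \<theta>) = (\<Sum>l | l \<in> I \<and> compose K l \<theta> = t. \<phi> l j)"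
proof -
  have c: "compatible K \<theta> id i l \<longleftrightarrow> i = compose K l \<theta>" if "i \<in> I" "l \<in> I" for i l
  proof
    assume c: "compatible K \<theta> id i l"
    show "i = compose K l \<theta>"
    proof (rule index_eqI[OF that(1) compose_in_I[OF that(2) \<theta>]])
      fix k assume "k \<in> K"
      then have "\<theta> k \<in> K" using \<theta>(1) by auto
      then have "i k = l (\<theta> k)" using compatible_top_bottom[OF c \<open>k \<in> K\<close>, of "\<theta> k"] by simp
      then show "i k = compose K l \<theta> k" using \<open>k \<in> K\<close> by (simp add: compose_def)
    qed
  next
    assume "i = compose K l \<theta>"
    then show "compatible K \<theta> id i l" by (auto simp: compatible_def compose_def)
  qed
  have "(\<Sum>i | i \<in> I \<and> compatible K \<theta> id i j. \<phi> t i) = (\<Sum>i \<in> {compose K j \<theta>}. \<phi> t i)"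
    by (rule sum.cong) (use c assms compose_in_I[OF assms(2) \<theta>] in auto)
  moreover have "(\<Sum>l | l \<in> I \<and> compatible K \<theta> id t l. \<phi> l j) = (\<Sum>l | l \<in> I \<and> compose K l \<theta> = t. \<phi> l j)"
    by (rule sum.cong) (use c assms in auto)
  ultimately show ?thesis using comm[of \<theta> id t j] assms by simp
qed

text \<open>A relabelling \<open>\<theta>\<close> turns \<open>(i, j)\<close> into
  \<open>(i', j')\<close>. In the resulting sum over \<open>l\<close> only \<open>l = i\<close>
  survives: every column of \<open>(i, j)\<close> coincides with one in the range of
  \<open>\<theta>\<close>, and where \<open>\<phi> l j\<close> is nonzero \<open>l\<close> has the
  same coincidences as \<open>j\<close>.\<close>

lemma depends_on_index_graph:
  assumes I: "i \<in> I" "j \<in> I" "i' \<in> I" "j' \<in> I" and eq: "index_graph K i j = index_graph K i' j'"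
  shows "\<phi> i' j' = \<phi> i j"
proof -
  have "\<exists>k\<in>K. j k = j' k' \<and> i k = i' k'" if "k' \<in> K" for k'
  proof -
    have "(j' k', i' k') \<in> index_graph K i j" using that eq by (auto simp: index_graph_def)
    then show ?thesis by (auto simp: index_graph_def)
  qed
  then obtain \<theta>0 where \<theta>0: "\<And>k'. k' \<in> K \<Longrightarrow> \<theta>0 k' \<in> K \<and> j (\<theta>0 k') = j' k' \<and> i (\<theta>0 k') = i' k'"
    by metis
  \<comment> \<open>\<open>push_forward\<close> demands that \<open>Z\<close> be fixed; resetting
    \<open>\<theta>0\<close> there is harmless because all four indices have the value
    \<open>n\<close> on \<open>Z\<close>.\<close>
  define \<theta> where "\<theta> k = (if k \<in> Z then k else \<theta>0 k)" for k
  have pin: "l z = n" if "l \<in> I" "z \<in> Z" for l z using that by (auto simp: pinned_index_def)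
  have \<theta>: "\<theta> k' \<in> K" "j (\<theta> k') = j' k'" "i (\<theta> k') = i' k'" if "k' \<in> K" for k'
    using \<theta>0[OF that] pin I that by (auto simp: \<theta>_def)
  have \<theta>K: "\<theta> \<in> K \<rightarrow> K" "\<And>z. z \<in> Z \<Longrightarrow> \<theta> z = z" using \<theta> by (auto simp: \<theta>_def)
  have i': "i' = compose K i \<theta>" and j': "j' = compose K j \<theta>"
    using I compose_in_I[OF _ \<theta>K] \<theta> by (auto intro!: index_eqI simp: compose_def)
  have zero: "\<phi> l j = 0" if "l \<in> I" "compose K l \<theta> = i'" "l \<noteq> i" for l
  proof (rule ccontr)
    assume nz: "\<phi> l j \<noteq> 0"
    have "l = i"
    proof (rule index_eqI[OF that(1) I(1)])
      fix k assume k: "k \<in> K"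
      then have "(j k, i k) \<in> index_graph K i' j'" using eq by (auto simp: index_graph_def)
      then obtain k' where k': "k' \<in> K" "j k = j' k'" "i k = i' k'" by (auto simp: index_graph_def)
      have "l k = l (\<theta> k')" using same_kernel[OF that(1) I(2) nz k \<theta>(1)[OF k'(1)]] k' \<theta> by simp
      also have "\<dots> = i' k'" using fun_cong[OF that(2), of k'] k'(1) by (simp add: compose_def)
      finally show "l k = i k" using k' by simp
    qed
    then show False using that by simp
  qed
  have "\<phi> i' j' = (\<Sum>l | l \<in> I \<and> compose K l \<theta> = i'. \<phi> l j)"
    unfolding j' by (rule push_forward[OF I(3,2) \<theta>K])
  also have "\<dots> = (\<Sum>l\<in>{i}. \<phi> l j)"
    by (rule sum.mono_neutral_right) (use finite_I I i' zero in auto)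
  finally show ?thesis by simp
qed

text \<open>Column \<open>e\<close> repeats column \<open>e0\<close>, so \<open>j\<close> arises
  from \<open>j(e := x)\<close> by redirecting \<open>e\<close> to \<open>e0\<close>, and
  \<open>push_forward\<close> frees the entry of \<open>i\<close> at \<open>e\<close>. Since
  \<open>x\<close> is new, a value \<open>y\<close> already in use creates a coincidence on one side
  only, and the entry vanishes.\<close>

lemma sum_free_values:
  assumes I: "i \<in> I" "j \<in> I" and e: "e \<in> K - Z" "e0 \<in> K" "e0 \<noteq> e" "i e = i e0" "j e = j e0"
    and x: "x \<in> {1..n} - j ` K"
  shows "\<phi> i j = (\<Sum>y\<in>{1..n} - i ` K. \<phi> (i(e := y)) (j(e := x)))"
proof -
  let ?j = "j(e := x)" and ?\<theta> = "id(e := e0)"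
  have upd: "l(e := y) \<in> I" if "l \<in> I" "y \<in> {1..n}" for l y
    using that e(1) by (auto simp: pinned_index_def PiE_def extensional_def)
  have \<theta>K: "?\<theta> \<in> K \<rightarrow> K" "\<And>z. z \<in> Z \<Longrightarrow> ?\<theta> z = z" using e by auto
  have j1: "?j \<in> I" using upd I(2) x by simp
  have "j = compose K ?j ?\<theta>"
    by (rule index_eqI[OF I(2) compose_in_I[OF j1 \<theta>K]]) (use e in \<open>auto simp: compose_def\<close>)
  then have "\<phi> i j = \<phi> i (compose K ?j ?\<theta>)" by (rule arg_cong)
  also have "\<dots> = (\<Sum>l | l \<in> I \<and> compose K l ?\<theta> = i. \<phi> l ?j)"
    by (rule push_forward[OF I(1) j1 \<theta>K])
  also have "{l. l \<in> I \<and> compose K l ?\<theta> = i} = (\<lambda>y. i(e := y)) ` {1..n}"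
  proof (intro equalityI subsetI)
    fix l assume l: "l \<in> {l. l \<in> I \<and> compose K l ?\<theta> = i}"
    then have lI: "l \<in> I" and c: "compose K l ?\<theta> = i" by auto
    have y: "l e \<in> {1..n}" using lI e(1) by (auto simp: pinned_index_def)
    have "l = i(e := l e)"
    proof (rule index_eqI[OF lI upd[OF I(1) y]])
      fix k assume "k \<in> K"
      then show "l k = (i(e := l e)) k" using fun_cong[OF c, of k] by (auto simp: compose_def)
    qed
    then show "l \<in> (\<lambda>y. i(e := y)) ` {1..n}" using y by blast
  next
    fix l assume "l \<in> (\<lambda>y. i(e := y)) ` {1..n}"
    then obtain y where y: "y \<in> {1..n}" "l = i(e := y)" by blast
    then have lI: "l \<in> I" using upd I(1) by simp
    have "compose K l ?\<theta> = i"
      by (rule index_eqI[OF compose_in_I[OF lI \<theta>K] I(1)]) (use e y in \<open>auto simp: compose_def\<close>)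
    then show "l \<in> {l. l \<in> I \<and> compose K l ?\<theta> = i}" using lI by simp
  qed
  also have "(\<Sum>l\<in>(\<lambda>y. i(e := y)) ` {1..n}. \<phi> l ?j) = (\<Sum>y\<in>{1..n}. \<phi> (i(e := y)) ?j)"
    by (subst sum.reindex) (auto simp: inj_on_def fun_eq_iff split: if_splits)
  also have "\<dots> = (\<Sum>y\<in>{1..n} - i ` K. \<phi> (i(e := y)) ?j)"
  proof (rule sum.mono_neutral_right)
    show "\<forall>y\<in>{1..n} - ({1..n} - i ` K). \<phi> (i(e := y)) ?j = 0"
    proof
      fix y assume y: "y \<in> {1..n} - ({1..n} - i ` K)"
      then obtain k0 where k0: "k0 \<in> K" "y = i k0" by auto
      \<comment> \<open>If \<open>y\<close> is attained at \<open>e\<close> itself, it is attained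
        at \<open>e0\<close> too, which gives a column different from \<open>e\<close>.\<close>
      define k where "k = (if k0 = e then e0 else k0)"
      have k: "k \<in> K" "y = i k" "k \<noteq> e" using k0 e by (auto simp: k_def)
      have "?j k \<noteq> ?j e" using k x by auto
      then show "\<phi> (i(e := y)) ?j = 0"
        using same_kernel[OF upd[OF I(1)] j1, of y k e] y k e(1) by auto
    qed
  qed auto
  finally show ?thesis .
qed

end

text \<open>Writing \<open>R\<close> with a repeated pair leaves a column \<open>e\<close> that can
  be overwritten without losing an element of \<open>R\<close>; \<open>z0\<close> will be the pinned
  position, if there is one.\<close>

lemma surjection_with_repetition:
  assumes "finite K" "finite R" "card R < card K" "p0 \<in> R" "z0 \<in> K"
  shows "\<exists>g e. g ` K = R \<and> g z0 = p0 \<and> e \<in> K - {z0} \<and> g e = p0"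
proof -
  have "card R > 0" using assms card_gt_0_iff by blast
  then have "card (K - {z0}) > 0" using assms by simp
  then obtain e where e: "e \<in> K - {z0}" by (metis card_gt_0_iff ex_in_conv)
  have "card (R - {p0}) \<le> card (K - {z0, e})"
  proof -
    have "card {z0, e} = 2" using e by auto
    then show ?thesis using assms e by (simp add: card_Diff_subset)
  qed
  then obtain f where f: "f ` (R - {p0}) \<subseteq> K - {z0, e}" "inj_on f (R - {p0})"
    using card_le_inj[of "R - {p0}" "K - {z0, e}"] assms(1,2) by auto
  define g where "g k = (if k \<in> f ` (R - {p0}) then inv_into (R - {p0}) f k else p0)" for k
  have "g k \<in> R" for k
    using inv_into_into[of k f "R - {p0}"] assms(4) by (auto simp: g_def)
  moreover have "p \<in> g ` K" if "p \<in> R" "p \<noteq> p0" for p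
  proof (rule image_eqI[of _ _ "f p"])
    show "p = g (f p)" using f(2) that by (simp add: g_def)
    show "f p \<in> K" using f(1) that by auto
  qed
  moreover have "g z0 = p0" "g e = p0" using f(1) by (auto simp: g_def)
  ultimately show ?thesis using e assms(5) by (intro exI[of _ g] exI[of _ e]) auto
qed

context invariant_kernel
begin

text \<open>The choice is immaterial by \<open>depends_on_index_graph\<close>. On sets that are not
  index graphs, such as \<open>{}\<close> for nonempty \<open>K\<close>, the value is
  meaningless.\<close>

definition matching_weight :: "(nat \<times> nat) set \<Rightarrow> 'b" where
  "matching_weight R =
     (let (i, j) = SOME (i, j). i \<in> I \<and> j \<in> I \<and> index_graph K i j = R in \<phi> i j)"

lemma matching_weight_index_graph:
  assumes "i \<in> I" "j \<in> I"
  shows "matching_weight (index_graph K i j) = \<phi> i j"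
proof -
  let ?Q = "\<lambda>p. fst p \<in> I \<and> snd p \<in> I \<and> index_graph K (fst p) (snd p) = index_graph K i j"
  have "?Q (SOME p. ?Q p)" by (rule someI[of ?Q "(i, j)"]) (use assms in simp)
  then have "\<phi> (fst (SOME p. ?Q p)) (snd (SOME p. ?Q p)) = \<phi> i j"
    using assms by (intro depends_on_index_graph) auto
  then show ?thesis unfolding matching_weight_def by (simp add: case_prod_unfold Let_def)
qed

text \<open>Inserting a pair means overwriting the repeated column \<open>e\<close>, so
  \<open>sum_free_values\<close> and its transpose apply. A pair to repeat exists only if
  \<open>R\<close> is nonempty.\<close>

lemma matching_weight_sum:
  assumes R: "matching n R" "R \<noteq> {}" "card R < card K"
    and pin: "Z \<noteq> {} \<Longrightarrow> (n, n) \<in> R" "card Z \<le> 1"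
  shows "x \<in> {1..n} - fst ` R \<Longrightarrow>
      matching_weight R = (\<Sum>y\<in>{1..n} - snd ` R. matching_weight (insert (x, y) R))"
    and "y \<in> {1..n} - snd ` R \<Longrightarrow>
      matching_weight R = (\<Sum>x\<in>{1..n} - fst ` R. matching_weight (insert (x, y) R))"
proof -
  have finZ: "finite Z" using Z finite_K finite_subset by blast
  obtain p0 z0 where p0: "p0 \<in> R" "z0 \<in> K" "Z \<noteq> {} \<Longrightarrow> Z = {z0} \<and> p0 = (n, n)"
  proof (cases "Z = {}")
    case True
    have "K \<noteq> {}" using R(3) by auto
    then obtain k where "k \<in> K" by blast
    moreover obtain p where "p \<in> R" using R(2) by blast
    ultimately have "p \<in> R" "k \<in> K" by auto
    then show ?thesis by (rule that) (use True in simp)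
  next
    case False
    then have "card Z = 1" using pin(2) finZ by (simp add: le_antisym Suc_le_eq card_gt_0_iff)
    then obtain z where "Z = {z}" by (auto simp: card_1_singleton_iff)
    then show ?thesis using pin(1) Z by (intro that[of "(n, n)" z]) simp_all
  qed
  obtain g e where g: "g ` K = R" "g z0 = p0" "e \<in> K - {z0}" "g e = p0"
    using surjection_with_repetition[OF finite_K matching_finite[OF R(1)] R(3) p0(1,2)] by blast
  define i where "i = restrict (snd \<circ> g) K"
  define j where "j = restrict (fst \<circ> g) K"
  have gm: "fst (g k) \<in> {1..n} \<and> snd (g k) \<in> {1..n}" if "k \<in> K" for k
    using that g(1) R(1) unfolding matching_def by fastforce
  have gZ: "g z = (n, n)" if "z \<in> Z" for z using p0(3) g(2) that by blast
  have I: "i \<in> I" "j \<in> I"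
    unfolding pinned_index_def using gm gZ Z by (auto simp: i_def j_def)
  have gr: "index_graph K i j = R"
    unfolding index_graph_def g(1)[symmetric] by (rule image_cong) (auto simp: i_def j_def)
  have im: "i ` K = snd ` R" "j ` K = fst ` R"
    unfolding g(1)[symmetric] image_image by (auto simp: i_def j_def)
  have e: "e \<in> K - Z" "z0 \<in> K" "z0 \<noteq> e" "i e = i z0" "j e = j z0"
    using g p0 by (auto simp: i_def j_def)
  have upd: "l(e := y) \<in> I" if "l \<in> I" "y \<in> {1..n}" for l y
    using that e(1) by (auto simp: pinned_index_def PiE_def extensional_def)
  have ins: "matching_weight (insert (x, y) R) = \<phi> (i(e := y)) (j(e := x))"
    if "x \<in> {1..n}" "y \<in> {1..n}" for x y
  proof -
    have "index_graph K (i(e := y)) (j(e := x)) = insert (x, y) R"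
    proof -
      have "index_graph K (i(e := y)) (j(e := x)) = insert (x, y) ((\<lambda>k. (j k, i k)) ` (K - {e}))"
      proof -
        have "K = insert e (K - {e})" using e(1) by auto
        then have "index_graph K (i(e := y)) (j(e := x))
            = (\<lambda>k. ((j(e := x)) k, (i(e := y)) k)) ` insert e (K - {e})"
          unfolding index_graph_def by (rule arg_cong)
        also have "\<dots> = insert (x, y) ((\<lambda>k. ((j(e := x)) k, (i(e := y)) k)) ` (K - {e}))"
          by (simp only: image_insert fun_upd_same)
        also have "(\<lambda>k. ((j(e := x)) k, (i(e := y)) k)) ` (K - {e}) = (\<lambda>k. (j k, i k)) ` (K - {e})"
          by (rule image_cong) auto
        finally show ?thesis .
      qed
      also have "(\<lambda>k. (j k, i k)) ` (K - {e}) = (\<lambda>k. (j k, i k)) ` K"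
      proof
        have "(j e, i e) \<in> (\<lambda>k. (j k, i k)) ` (K - {e})" using e by (intro image_eqI[of _ _ z0]) auto
        then show "(\<lambda>k. (j k, i k)) ` K \<subseteq> (\<lambda>k. (j k, i k)) ` (K - {e})" by blast
      qed auto
      finally show ?thesis using gr by (simp add: index_graph_def)
    qed
    then show ?thesis
      using matching_weight_index_graph[OF upd[OF I(1) that(2)] upd[OF I(2) that(1)]] by simp
  qed
  have w: "matching_weight R = \<phi> i j" using matching_weight_index_graph[OF I] gr by simp
  show "matching_weight R = (\<Sum>y\<in>{1..n} - snd ` R. matching_weight (insert (x, y) R))"
    if x: "x \<in> {1..n} - fst ` R"
    using sum_free_values[OF I e, of x] x ins unfolding w im by simp
  show "matching_weight R = (\<Sum>x\<in>{1..n} - fst ` R. matching_weight (insert (x, y) R))"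
    if y: "y \<in> {1..n} - snd ` R"
    using invariant_kernel.sum_free_values[OF transpose I(2,1) e(1-3,5,4), of y] y ins unfolding w im by simp
qed

text \<open>Some coincidence occurs in only one of \<open>i\<close> and \<open>j\<close>, which no
  permutation carrying \<open>j\<close> to \<open>i\<close> allows. For such entries the wanted
  formula reads \<open>0 = 0\<close>.\<close>

lemma not_matching_index_graph:
  assumes "i \<in> I" "j \<in> I" "\<not> matching n (index_graph K i j)"
  shows "\<phi> i j = 0" and "extensions n (index_graph K i j) = {}"
proof -
  have "index_graph K i j \<subseteq> {1..n} \<times> {1..n}"
    using assms(1,2) by (auto simp: index_graph_def pinned_index_def)
  then have "\<not> (inj_on fst (index_graph K i j) \<and> inj_on snd (index_graph K i j))"
    using assms(3) by (auto simp: matching_def)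
  then obtain a b where ab: "a \<in> K" "b \<in> K" "\<not> (i a = i b \<longleftrightarrow> j a = j b)"
    by (auto simp: inj_on_def index_graph_def)
  then show "\<phi> i j = 0" using same_kernel[OF assms(1,2)] by blast
  show "extensions n (index_graph K i j) = {}"
  proof (rule ccontr)
    assume "extensions n (index_graph K i j) \<noteq> {}"
    then obtain \<sigma> where s: "\<sigma> permutes {1..n}" "\<And>k. k \<in> K \<Longrightarrow> \<sigma> (j k) = i k"
      by (auto simp: extensions_def index_graph_def)
    then have "i a = i b \<longleftrightarrow> j a = j b"
      using ab(1,2) permutes_inj[OF s(1)] by (metis injD)
    then show False using ab(3) by simp
  qed
qed

text \<open>Only \<open>w {}\<close> is not a matrix entry: it is defined as a row sum over
  matchings of size one, and coherence at \<open>{}\<close> asks that all row sums and column sums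
  agree.\<close>

lemma kernel_eq_sum_extensions:
  assumes "Z = {}" "K \<noteq> {}"
  shows "\<exists>c. \<forall>i\<in>I. \<forall>j\<in>I. \<phi> i j = (\<Sum>\<sigma>\<in>extensions n (index_graph K i j). c \<sigma>)"
proof -
  have const: "restrict (\<lambda>_. y) K \<in> I" if "y \<in> {1..n}" for y
    using that assms(1) by (auto simp: pinned_index_def)
  have gr: "index_graph K (restrict (\<lambda>_. y) K) (restrict (\<lambda>_. x) K) = {(x, y)}" for x y
    using assms(2) by (auto simp: index_graph_def)
  have wt: "matching_weight {(x, y)} = \<phi> (restrict (\<lambda>_. y) K) (restrict (\<lambda>_. x) K)"
    if "x \<in> {1..n}" "y \<in> {1..n}" for x y
    using matching_weight_index_graph[OF const[OF that(2)] const[OF that(1)]] gr by simp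
  have inj: "inj_on (\<lambda>y. restrict (\<lambda>_. y) K) {1..n}"
  proof (rule inj_onI)
    fix y y' assume eq: "restrict (\<lambda>_. y) K = restrict (\<lambda>_. y') K"
    obtain k where "k \<in> K" using assms(2) by blast
    then show "y = y'" using fun_cong[OF eq, of k] by simp
  qed
  have comp: "compatible K (\<lambda>_. 0) (\<lambda>_. 1) i l \<longleftrightarrow>
      i \<in> (\<lambda>y. restrict (\<lambda>_. y) K) ` {1..n} \<and> l \<in> (\<lambda>y. restrict (\<lambda>_. y) K) ` {1..n}"
    if il: "i \<in> I" "l \<in> I" for i l
  proof
    assume c: "compatible K (\<lambda>_. 0) (\<lambda>_. 1) i l"
    obtain k where k: "k \<in> K" using assms(2) by blast
    have ik: "i k \<in> {1..n}" "l k \<in> {1..n}" using il k by (auto simp: pinned_index_def)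
    have "i = restrict (\<lambda>_. i k) K"
      by (rule index_eqI[OF il(1) const[OF ik(1)]]) (use compatible_top[OF c _ k] in simp)
    moreover have "l = restrict (\<lambda>_. l k) K"
      by (rule index_eqI[OF il(2) const[OF ik(2)]]) (use compatible_bottom[OF c _ k] in simp)
    ultimately show "i \<in> (\<lambda>y. restrict (\<lambda>_. y) K) ` {1..n} \<and> l \<in> (\<lambda>y. restrict (\<lambda>_. y) K) ` {1..n}"
      using ik by blast
  qed (auto simp: compatible_def)
  \<comment> \<open>the diagram with the two blocks top and bottom row makes \<open>w {}\<close> well defined\<close>
  have tot: "(\<Sum>x'\<in>{1..n}. matching_weight {(x', y)}) = (\<Sum>y'\<in>{1..n}. matching_weight {(x, y')})"
    if xy: "x \<in> {1..n}" "y \<in> {1..n}" for x y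
  proof -
    let ?k = "\<lambda>y. restrict (\<lambda>_. y) K"
    have "(\<Sum>i | i \<in> I \<and> compatible K (\<lambda>_. 0) (\<lambda>_. 1) i (?k x). \<phi> (?k y) i)
        = (\<Sum>l | l \<in> I \<and> compatible K (\<lambda>_. 0) (\<lambda>_. 1) (?k y) l. \<phi> l (?k x))"
      by (rule comm) (use assms(1) const xy in auto)
    also have "{i. i \<in> I \<and> compatible K (\<lambda>_. 0) (\<lambda>_. 1) i (?k x)} = ?k ` {1..n}"
      using comp[OF _ const[OF xy(1)]] const xy by blast
    also have "{l. l \<in> I \<and> compatible K (\<lambda>_. 0) (\<lambda>_. 1) (?k y) l} = ?k ` {1..n}"
      using comp[OF const[OF xy(2)]] const xy by blast
    finally show ?thesis
      unfolding sum.reindex[OF inj] using xy wt by simp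
  qed
  define w where "w R = (if R = {} then \<Sum>y\<in>{1..n}. matching_weight {(1, y)} else matching_weight R)" for R
  have "coherent n (card K) w"
    unfolding coherent_def
  proof (intro allI impI conjI ballI)
    fix R x assume R: "matching n R \<and> card R < card K" and x: "x \<in> {1..n} - fst ` R"
    show "w R = (\<Sum>y\<in>{1..n} - snd ` R. w (insert (x, y) R))"
    proof (cases "R = {}")
      case True
      have "1 \<in> {1..n}" using x by auto
      \<comment> \<open>The rows of \<open>x\<close> and of \<open>1\<close> are compared through
        column \<open>1\<close>.\<close>
      then have "w {} = (\<Sum>y\<in>{1..n}. matching_weight {(x, y)})"
        using tot[of x 1] tot[of 1 1] x True by (simp add: w_def)
      then show ?thesis using True by (simp add: w_def)
    next
      case False
      then show ?thesis using matching_weight_sum(1)[of R x] R x assms(1) by (simp add: w_def)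
    qed
  next
    fix R y assume R: "matching n R \<and> card R < card K" and y: "y \<in> {1..n} - snd ` R"
    show "w R = (\<Sum>x\<in>{1..n} - fst ` R. w (insert (x, y) R))"
    proof (cases "R = {}")
      case True
      have "1 \<in> {1..n}" using y by auto
      then have "w {} = (\<Sum>x\<in>{1..n}. matching_weight {(x, y)})"
        using tot[of 1 y] y True by (simp add: w_def)
      then show ?thesis using True by (simp add: w_def)
    next
      case False
      then show ?thesis using matching_weight_sum(2)[of R y] R y assms(1) by (simp add: w_def)
    qed
  qed
  then obtain c where c: "\<And>R. matching n R \<Longrightarrow> card R \<le> card K \<Longrightarrow> w R = (\<Sum>\<sigma>\<in>extensions n R. c \<sigma>)"
    using coherent_eq_sum_extensions by blast
  have "\<phi> i j = (\<Sum>\<sigma>\<in>extensions n (index_graph K i j). c \<sigma>)" if ij: "i \<in> I" "j \<in> I" for i j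
  proof (cases "matching n (index_graph K i j)")
    case True
    have "card (index_graph K i j) \<le> card K" "index_graph K i j \<noteq> {}"
      using assms(2) finite_K by (auto simp: index_graph_def card_image_le)
    then show ?thesis using c[OF True] matching_weight_index_graph[OF ij] by (simp add: w_def)
  qed (use not_matching_index_graph[OF ij] in simp)
  then show ?thesis by blast
qed

text \<open>The pinned column contributes \<open>(n, n)\<close> to every graph. Removing it leaves
  partial permutations of \<open>{1..n - 1}\<close> with at most \<open>card K - 1\<close> pairs.
  With \<open>(n, n)\<close> restored even the empty one becomes nonempty, so
  \<open>matching_weight_sum\<close> covers it.\<close>

lemma pinned_kernel_eq_sum_extensions:
  assumes "Z = {z}" "n > 0"
  shows "\<exists>c. \<forall>i\<in>I. \<forall>j\<in>I. \<phi> i j =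
    (\<Sum>\<sigma>\<in>extensions n (index_graph K i j). c \<sigma>)"
proof -
  let ?p = "(n, n)"
  define w where "w R = matching_weight (insert ?p R)" for R
  have rng: "{1..n} - insert n A = {1..n - 1} - A" for A using assms(2) by auto
  have m: "matching n (insert ?p R) \<and> (n, n) \<notin> R" if "matching (n - 1) R" for R
  proof -
    have "R \<subseteq> {1..n - 1} \<times> {1..n - 1}" using that by (simp add: matching_def)
    then have "matching n R" "n \<notin> fst ` R" "n \<notin> snd ` R"
      using that assms(2) by (fastforce simp: matching_def)+
    then show ?thesis using assms(2) by (force intro: matching_insert)
  qed
  have "coherent (n - 1) (card K - 1) w"
    unfolding coherent_def
  proof (intro allI impI conjI ballI)
    fix R x assume R: "matching (n - 1) R \<and> card R < card K - 1" and x: "x \<in> {1..n - 1} - fst ` R"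
    have c: "card (insert ?p R) < card K"
      using R card_insert_if[OF matching_finite, of "n - 1" R ?p] by (auto split: if_splits)
    have "matching_weight (insert ?p R)
        = (\<Sum>y\<in>{1..n} - snd ` insert ?p R. matching_weight (insert (x, y) (insert ?p R)))"
      by (rule matching_weight_sum(1)) (use m[of R] R c x assms in auto)
    then show "w R = (\<Sum>y\<in>{1..n - 1} - snd ` R. w (insert (x, y) R))"
      using rng[of "snd ` R"] by (simp add: w_def insert_commute)
  next
    fix R y assume R: "matching (n - 1) R \<and> card R < card K - 1" and y: "y \<in> {1..n - 1} - snd ` R"
    have c: "card (insert ?p R) < card K"
      using R card_insert_if[OF matching_finite, of "n - 1" R ?p] by (auto split: if_splits)
    have "matching_weight (insert ?p R)
        = (\<Sum>x\<in>{1..n} - fst ` insert ?p R. matching_weight (insert (x, y) (insert ?p R)))"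
      by (rule matching_weight_sum(2)) (use m[of R] R c y assms in auto)
    then show "w R = (\<Sum>x\<in>{1..n - 1} - fst ` R. w (insert (x, y) R))"
      using rng[of "fst ` R"] by (simp add: w_def insert_commute)
  qed
  then obtain c where c: "\<And>R. matching (n - 1) R \<Longrightarrow> card R \<le> card K - 1 \<Longrightarrow>
      w R = (\<Sum>\<sigma>\<in>extensions (n - 1) R. c \<sigma>)"
    using coherent_eq_sum_extensions by blast
  have "\<phi> i j = (\<Sum>\<sigma>\<in>extensions n (index_graph K i j). c \<sigma>)" if ij: "i \<in> I" "j \<in> I" for i j
  proof (cases "matching n (index_graph K i j)")
    case True
    let ?G = "index_graph K i j"
    have zK: "z \<in> K" using Z assms(1) by simp
    have p: "?p \<in> ?G" using ij zK assms(1) by (force simp: index_graph_def pinned_index_def)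
    let ?R = "?G - {?p}"
    have ne: "fst q \<noteq> n \<and> snd q \<noteq> n" if "q \<in> ?R" for q
      using that True p by (auto simp: matching_def inj_on_def)
    have mR: "matching (n - 1) ?R"
    proof -
      have "q \<in> {1..n - 1} \<times> {1..n - 1}" if "q \<in> ?R" for q
      proof -
        have "q \<in> {1..n} \<times> {1..n}" using that True by (auto simp: matching_def)
        then show ?thesis using ne[OF that] by (cases q) auto
      qed
      moreover have "inj_on fst ?R" "inj_on snd ?R"
        using True by (auto simp: matching_def intro: inj_on_subset)
      ultimately show ?thesis unfolding matching_def by blast
    qed
    have "card ?G \<le> card K" using finite_K by (simp add: index_graph_def card_image_le)
    then have "card ?R \<le> card K - 1" using p matching_finite[OF True] by simp
    then have "\<phi> i j = (\<Sum>\<sigma>\<in>extensions (n - 1) ?R. c \<sigma>)"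
      using c[OF mR] matching_weight_index_graph[OF ij] p by (simp add: w_def insert_absorb)
    also have "extensions (n - 1) ?R = extensions n ?G"
    proof (intro equalityI subsetI)
      fix \<sigma> assume s: "\<sigma> \<in> extensions (n - 1) ?R"
      then have p1: "\<sigma> permutes {1..n - 1}" by (simp add: extensions_def)
      have "\<sigma> n = n" using assms(2) by (intro permutes_not_in[OF p1]) auto
      moreover have "\<sigma> permutes {1..n}" by (rule permutes_subset[OF p1]) auto
      ultimately show "\<sigma> \<in> extensions n ?G" using s by (auto simp: extensions_def)
    next
      fix \<sigma> assume s: "\<sigma> \<in> extensions n ?G"
      then have "\<sigma> permutes {1..n}" "\<sigma> n = n" using p by (auto simp: extensions_def)
      moreover have "{1..n} - {1..n - 1} \<subseteq> {n}" by auto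
      ultimately have "\<sigma> permutes {1..n - 1}" using permutes_superset by blast
      then show "\<sigma> \<in> extensions (n - 1) ?R" using s by (auto simp: extensions_def)
    qed
    finally show ?thesis .
  qed (use not_matching_index_graph[OF ij] in simp)
  then show ?thesis by auto
qed

end

section \<open>Endomorphisms of tensor space\<close>

lemma finite_multi_index: "finite (multi_index n r)"
  by (simp add: multi_index_def finite_PiE)

lemma finite_diagrams: "finite (diagrams r)"
proof (rule finite_subset)
  show "diagrams r \<subseteq> Pow (Pow ({1..r} <+> {1..r}))"
    by (auto simp: diagrams_def partition_on_def)
qed simp

lemma basis_vec_in_free_module: "s \<in> S \<Longrightarrow> basis_vec s \<in> free_module S"
  by (auto simp: basis_vec_def free_module_def)

lemma sum_basis_vec:
  fixes g :: "'s \<Rightarrow> 'b::{comm_ring,comm_monoid_mult}"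
  assumes "finite S" "s \<in> S"
  shows "(\<Sum>t\<in>S. basis_vec s t * g t) = g s" and "(\<Sum>t\<in>S. g t * basis_vec t s) = g s"
proof -
  have "(\<Sum>t\<in>S. basis_vec s t * g t) = (\<Sum>t\<in>S. if t = s then g t else 0)"
    by (rule sum.cong) (auto simp: basis_vec_def)
  then show "(\<Sum>t\<in>S. basis_vec s t * g t) = g s" using assms by simp
  have "(\<Sum>t\<in>S. g t * basis_vec t s) = (\<Sum>t\<in>S. if t = s then g t else 0)"
    by (rule sum.cong) (auto simp: basis_vec_def)
  then show "(\<Sum>t\<in>S. g t * basis_vec t s) = g s" using assms by simp
qed

lemma linear_endo_apply:
  fixes f :: "('s \<Rightarrow> 'b::{comm_ring,comm_monoid_mult}) \<Rightarrow> 's \<Rightarrow> 'b"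
  assumes "finite S" and f: "f \<in> linear_endos S" and x: "x \<in> free_module S"
  shows "f x t = (\<Sum>s\<in>S. x s * f (basis_vec s) t)"
proof -
  have add: "f (\<lambda>s. y s + z s) = (\<lambda>s. f y s + f z s)" if "y \<in> free_module S" "z \<in> free_module S" for y z
    using f that unfolding linear_endos_def by blast
  have scale: "f (\<lambda>s. c * y s) = (\<lambda>s. c * f y s)" if "y \<in> free_module S" for c y
    using f that unfolding linear_endos_def by blast
  have "f (\<lambda>t. \<Sum>s\<in>A. x s * basis_vec s t) = (\<lambda>t. \<Sum>s\<in>A. x s * f (basis_vec s) t)" if "A \<subseteq> S" for A
    using finite_subset[OF that assms(1)] that
  proof (induction A rule: finite_induct)
    case empty
    have "(\<lambda>_. 0) \<in> free_module S" by (simp add: free_module_def)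
    from scale[OF this, of 0] show ?case by simp
  next
    case (insert s A)
    have m: "(\<lambda>t. x s * basis_vec s t) \<in> free_module S" "basis_vec s \<in> free_module S"
      "(\<lambda>t. \<Sum>s\<in>A. x s * basis_vec s t) \<in> free_module S"
      using insert.prems by (auto simp: free_module_def basis_vec_def intro!: sum.neutral)
    show ?case
      using insert by (simp add: add[OF m(1,3)] scale[OF m(2)])
  qed
  from this[of S] have "f (\<lambda>t. \<Sum>s\<in>S. x s * basis_vec s t) t = (\<Sum>s\<in>S. x s * f (basis_vec s) t)" by simp
  moreover have "(\<lambda>t. \<Sum>s\<in>S. x s * basis_vec s t) = x"
  proof
    fix t show "(\<Sum>s\<in>S. x s * basis_vec s t) = x t"
    proof (cases "t \<in> S")
      case False
      then have "(\<Sum>s\<in>S. x s * basis_vec s t) = 0" by (intro sum.neutral) (auto simp: basis_vec_def)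
      then show ?thesis using False x by (simp add: free_module_def)
    qed (use sum_basis_vec(2)[OF assms(1)] in blast)
  qed
  ultimately show ?thesis by simp
qed

lemma linear_endo_in_free_module: "f \<in> linear_endos S \<Longrightarrow> x \<in> free_module S \<Longrightarrow> f x \<in> free_module S"
  unfolding linear_endos_def by blast

lemma linear_endo_eqI:
  assumes "finite S" and f: "f \<in> linear_endos S" and g: "g \<in> linear_endos S"
    and eq: "\<And>s t. s \<in> S \<Longrightarrow> t \<in> S \<Longrightarrow> f (basis_vec s) t = g (basis_vec s) t"
  shows "f = g"
proof (rule PiE_ext)
  show "f \<in> free_module S \<rightarrow>\<^sub>E free_module S" "g \<in> free_module S \<rightarrow>\<^sub>E free_module S"
    using f g by (auto simp: linear_endos_def)
  fix x :: "'a \<Rightarrow> 'b" assume x: "x \<in> free_module S"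
  show "f x = g x"
  proof
    fix t show "f x t = g x t"
    proof (cases "t \<in> S")
      case True
      then show ?thesis
        using eq unfolding linear_endo_apply[OF assms(1) f x] linear_endo_apply[OF assms(1) g x] by simp
    next
      case False
      then show ?thesis
        using linear_endo_in_free_module[OF f x] linear_endo_in_free_module[OF g x]
        by (simp add: free_module_def)
    qed
  qed
qed

definition relation_matrix :: "('s \<Rightarrow> 's \<Rightarrow> bool) \<Rightarrow> 's \<Rightarrow> 's \<Rightarrow> 'b::{comm_ring,comm_monoid_mult}" where
  "relation_matrix R i j = (if R i j then 1 else 0)"

text \<open>The action is bilinear, so commuting with it is tested on basis diagrams and basis
  vectors, where it becomes an identity of matrix entries. \<open>rel d\<close> is the support of
  the 0-1 matrix of \<open>d\<close>; leaving it abstract serves both algebras.\<close>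

lemma module_End_iff:
  fixes act :: "('d \<Rightarrow> 'b::{comm_ring,comm_monoid_mult}) \<Rightarrow> ('s \<Rightarrow> 'b) \<Rightarrow> 's \<Rightarrow> 'b"
  assumes fin: "finite S" "finite D" and carrier: "carrier A = free_module D"
    and act: "\<And>a x t. a \<in> free_module D \<Longrightarrow> x \<in> free_module S \<Longrightarrow> act a x t =
      (if t \<in> S then \<Sum>d\<in>D. a d * (\<Sum>j\<in>S. x j * relation_matrix (rel d) t j) else 0)"
  shows "f \<in> module_End A act S \<longleftrightarrow> f \<in> linear_endos S \<and>
    (\<forall>d\<in>D. \<forall>t\<in>S. \<forall>j\<in>S. (\<Sum>i | i \<in> S \<and> rel d i j. f (basis_vec i) t)
      = (\<Sum>l | l \<in> S \<and> rel d t l. f (basis_vec j) l))" (is "_ \<longleftrightarrow> _ \<and> ?C")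
proof (cases "f \<in> linear_endos S")
  case f: True
  let ?L = "\<lambda>d t j. \<Sum>i | i \<in> S \<and> rel d i j. f (basis_vec i) t"
  let ?R = "\<lambda>d t j. \<Sum>l | l \<in> S \<and> rel d t l. f (basis_vec j) l"
  have sum_relation_matrix:
    "(\<Sum>i\<in>S. relation_matrix (rel d) i j * f (basis_vec i) t) = ?L d t j"
    "(\<Sum>l\<in>S. relation_matrix (rel d) t l * f (basis_vec j) l) = ?R d t j" for d t j
    by (rule sum.mono_neutral_cong_right; use fin in \<open>auto simp: relation_matrix_def\<close>)+
  have actS: "act a x \<in> free_module S" if "a \<in> free_module D" "x \<in> free_module S" for a x
    using act[OF that] by (simp add: free_module_def)
  have L: "f (act a x) t = (\<Sum>d\<in>D. a d * (\<Sum>j\<in>S. x j * ?L d t j))"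
    if a: "a \<in> free_module D" and x: "x \<in> free_module S" for a x t
  proof -
    have "f (act a x) t = (\<Sum>i\<in>S. (\<Sum>d\<in>D. a d * (\<Sum>j\<in>S. x j * relation_matrix (rel d) i j)) * f (basis_vec i) t)"
      unfolding linear_endo_apply[OF fin(1) f actS[OF a x]] by (rule sum.cong) (simp_all add: act[OF a x])
    also have "\<dots> = (\<Sum>i\<in>S. \<Sum>d\<in>D. \<Sum>j\<in>S. a d * (x j * (relation_matrix (rel d) i j * f (basis_vec i) t)))"
      by (simp add: sum_distrib_left sum_distrib_right mult.assoc)
    also have "\<dots> = (\<Sum>d\<in>D. \<Sum>i\<in>S. \<Sum>j\<in>S. a d * (x j * (relation_matrix (rel d) i j * f (basis_vec i) t)))"
      by (rule sum.swap)
    also have "\<dots> = (\<Sum>d\<in>D. \<Sum>j\<in>S. \<Sum>i\<in>S. a d * (x j * (relation_matrix (rel d) i j * f (basis_vec i) t)))"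
      by (rule sum.cong[OF refl]) (rule sum.swap)
    also have "\<dots> = (\<Sum>d\<in>D. a d * (\<Sum>j\<in>S. x j * (\<Sum>i\<in>S. relation_matrix (rel d) i j * f (basis_vec i) t)))"
      by (simp add: sum_distrib_left)
    finally show ?thesis by (simp only: sum_relation_matrix)
  qed
  have R: "act a (f x) t = (\<Sum>d\<in>D. a d * (\<Sum>j\<in>S. x j * ?R d t j))"
    if a: "a \<in> free_module D" and x: "x \<in> free_module S" and t: "t \<in> S" for a x t
  proof -
    have "(\<Sum>l\<in>S. f x l * relation_matrix (rel d) t l) = (\<Sum>j\<in>S. x j * ?R d t j)" for d
    proof -
      have "(\<Sum>l\<in>S. f x l * relation_matrix (rel d) t l)
          = (\<Sum>l\<in>S. \<Sum>j\<in>S. x j * (relation_matrix (rel d) t l * f (basis_vec j) l))"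
        unfolding linear_endo_apply[OF fin(1) f x] by (simp add: sum_distrib_left sum_distrib_right mult_ac)
      also have "\<dots> = (\<Sum>j\<in>S. \<Sum>l\<in>S. x j * (relation_matrix (rel d) t l * f (basis_vec j) l))"
        by (rule sum.swap)
      also have "\<dots> = (\<Sum>j\<in>S. x j * (\<Sum>l\<in>S. relation_matrix (rel d) t l * f (basis_vec j) l))"
        by (simp add: sum_distrib_left)
      finally show ?thesis by (simp only: sum_relation_matrix)
    qed
    then show ?thesis
      using act[OF a linear_endo_in_free_module[OF f x], of t] t by simp
  qed
  have "?C" if End: "f \<in> module_End A act S"
  proof (intro ballI)
    fix d t j assume d: "d \<in> D" and t: "t \<in> S" and j: "j \<in> S"
    have bd: "basis_vec d \<in> free_module D" and bj: "basis_vec j \<in> free_module S"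
      using d j by (auto intro: basis_vec_in_free_module)
    have "f (act (basis_vec d) (basis_vec j)) = act (basis_vec d) (f (basis_vec j))"
      using End bd bj carrier unfolding module_End_def by blast
    then have "(\<Sum>d'\<in>D. basis_vec d d' * (\<Sum>j'\<in>S. basis_vec j j' * ?L d' t j'))
        = (\<Sum>d'\<in>D. basis_vec d d' * (\<Sum>j'\<in>S. basis_vec j j' * ?R d' t j'))"
      using L[OF bd bj, of t] R[OF bd bj t] by simp
    then show "?L d t j = ?R d t j"
      by (simp only: sum_basis_vec(1)[OF fin(2) d] sum_basis_vec(1)[OF fin(1) j])
  qed
  moreover have "f \<in> module_End A act S" if C: "?C"
    unfolding module_End_def carrier
  proof (intro CollectI conjI f ballI)
    fix a :: "'d \<Rightarrow> 'b" and x :: "'s \<Rightarrow> 'b" assume a: "a \<in> free_module D" and x: "x \<in> free_module S"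
    show "f (act a x) = act a (f x)"
    proof
      fix t show "f (act a x) t = act a (f x) t"
      proof (cases "t \<in> S")
        case True
        then show ?thesis using C unfolding L[OF a x] R[OF a x True] by simp
      next
        case False
        then show ?thesis
          using linear_endo_in_free_module[OF f actS[OF a x]]
            actS[OF a linear_endo_in_free_module[OF f x]] by (simp add: free_module_def)
      qed
    qed
  qed
  ultimately show ?thesis using f by blast
qed (simp add: module_End_def)

section \<open>The permutation representation\<close>

lemma compose_in_multi_index:
  assumes "\<sigma> permutes {1..n}" "j \<in> multi_index n r"
  shows "compose {1..r} \<sigma> j \<in> multi_index n r"
  using assms(2) permutes_in_image[OF assms(1)] by (auto simp: multi_index_def compose_def)

lemma multi_index_eqI:
  assumes "i \<in> multi_index n r" "j \<in> multi_index n r" "\<And>k. k \<in> {1..r} \<Longrightarrow> i k = j k"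
  shows "i = j"
  by (rule PiE_ext[OF assms(1,2)[unfolded multi_index_def]]) (rule assms(3))

lemma perm_action_apply:
  "perm_action n r \<sigma> x t = (\<Sum>j\<in>multi_index n r. x j * basis_vec (compose {1..r} \<sigma> j) t)"
  by (simp add: perm_action_def lin_ext_def)

lemma perm_representation_linear:
  assumes P: "\<And>\<sigma>. \<sigma> \<in> carrier G \<Longrightarrow> \<sigma> permutes {1..n}"
  shows "perm_representation G n r a \<in> linear_endos (multi_index n r)"
proof -
  let ?M = "multi_index n r"
  let ?F = "perm_representation G n r a"
  have F: "?F x t = (\<Sum>\<sigma>\<in>carrier G. a \<sigma> * perm_action n r \<sigma> x t)" if "x \<in> free_module ?M" for x t
    using that by (simp add: perm_representation_def lin_ext_def)
  have pa0: "perm_action n r \<sigma> x t = 0" if "\<sigma> \<in> carrier G" "t \<notin> ?M" for \<sigma> x t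
    unfolding perm_action_apply
    using compose_in_multi_index[OF P[OF that(1)]] that(2)
    by (intro sum.neutral) (auto simp: basis_vec_def)
  have "?F x \<in> free_module ?M" if "x \<in> free_module ?M" for x
    unfolding free_module_def by (auto simp: F[OF that] pa0 intro!: sum.neutral)
  moreover have "?F \<in> extensional (free_module ?M)" by (simp add: perm_representation_def)
  moreover have "?F (\<lambda>s. x s + y s) = (\<lambda>s. ?F x s + ?F y s)"
    if xy: "x \<in> free_module ?M" "y \<in> free_module ?M" for x y
  proof -
    have "(\<lambda>s. x s + y s) \<in> free_module ?M" using xy by (simp add: free_module_def)
    then show ?thesis
      using xy by (simp add: F fun_eq_iff perm_action_apply distrib_left distrib_right sum.distrib)
  qed
  moreover have "?F (\<lambda>s. c * x s) = (\<lambda>s. c * ?F x s)" if x: "x \<in> free_module ?M" for c x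
  proof -
    have "(\<lambda>s. c * x s) \<in> free_module ?M" using x by (simp add: free_module_def)
    then show ?thesis
      using x by (simp add: F fun_eq_iff perm_action_apply sum_distrib_left mult_ac)
  qed
  ultimately show ?thesis unfolding linear_endos_def by (auto simp: PiE_def)
qed

lemma perm_representation_basis_vec:
  assumes "finite (carrier G)" "j \<in> multi_index n r"
  shows "perm_representation G n r a (basis_vec j) t
    = (\<Sum>\<sigma> | \<sigma> \<in> carrier G \<and> compose {1..r} \<sigma> j = t. a \<sigma>)"
proof -
  have "perm_representation G n r a (basis_vec j) t
      = (\<Sum>\<sigma>\<in>carrier G. a \<sigma> * perm_action n r \<sigma> (basis_vec j) t)"
    by (simp add: perm_representation_def lin_ext_def basis_vec_in_free_module[OF assms(2)])
  also have "\<dots> = (\<Sum>\<sigma>\<in>carrier G. a \<sigma> * basis_vec (compose {1..r} \<sigma> j) t)"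
    unfolding perm_action_apply
    using sum_basis_vec(1)[OF finite_multi_index assms(2)] by (intro sum.cong refl arg_cong2[where f = "(*)"]) 
  also have "\<dots> = (\<Sum>\<sigma> | \<sigma> \<in> carrier G \<and> compose {1..r} \<sigma> j = t. a \<sigma>)"
    by (rule sum.mono_neutral_cong_right) (use assms(1) in \<open>auto simp: basis_vec_def\<close>)
  finally show ?thesis .
qed

text \<open>Common frame for both algebras: invariance of \<open>rel\<close> under the group gives
  one inclusion, and \<open>surj\<close>, stated for matrix entries, the other.\<close>

lemma image_perm_representation_eq_module_End:
  fixes act :: "('d \<Rightarrow> 'b::{comm_ring,comm_monoid_mult}) \<Rightarrow> ((nat \<Rightarrow> nat) \<Rightarrow> 'b) \<Rightarrow> (nat \<Rightarrow> nat) \<Rightarrow> 'b"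
  assumes P: "\<And>\<sigma>. \<sigma> \<in> carrier G \<Longrightarrow> \<sigma> permutes {1..n}"
    and finD: "finite D" and carrier: "carrier A = free_module D"
    and act: "\<And>a x t. a \<in> free_module D \<Longrightarrow> x \<in> free_module (multi_index n r) \<Longrightarrow> act a x t =
      (if t \<in> multi_index n r
       then \<Sum>d\<in>D. a d * (\<Sum>j\<in>multi_index n r. x j * relation_matrix (rel d) t j) else 0)"
    and inv: "\<And>\<sigma> d i j. \<sigma> \<in> carrier G \<Longrightarrow> d \<in> D \<Longrightarrow> i \<in> multi_index n r \<Longrightarrow> j \<in> multi_index n r \<Longrightarrow>
      rel d (compose {1..r} \<sigma> i) (compose {1..r} \<sigma> j) \<longleftrightarrow> rel d i j"
    and surj: "\<And>f :: ((nat \<Rightarrow> nat) \<Rightarrow> 'b) \<Rightarrow> (nat \<Rightarrow> nat) \<Rightarrow> 'b. f \<in> linear_endos (multi_index n r) \<Longrightarrow>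
      (\<And>d t j. d \<in> D \<Longrightarrow> t \<in> multi_index n r \<Longrightarrow> j \<in> multi_index n r \<Longrightarrow>
        (\<Sum>i | i \<in> multi_index n r \<and> rel d i j. f (basis_vec i) t)
        = (\<Sum>l | l \<in> multi_index n r \<and> rel d t l. f (basis_vec j) l)) \<Longrightarrow>
      \<exists>c. \<forall>i\<in>multi_index n r. \<forall>j\<in>multi_index n r.
        f (basis_vec j) i = (\<Sum>\<sigma> | \<sigma> \<in> carrier G \<and> compose {1..r} \<sigma> j = i. c \<sigma>)"
  shows "perm_representation G n r ` carrier (group_algebra G) = module_End A act (multi_index n r)"
proof -
  let ?M = "multi_index n r" and ?F = "perm_representation G n r :: ((nat \<Rightarrow> nat) \<Rightarrow> 'b) \<Rightarrow> _"
  have finG: "finite (carrier G)"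
    by (rule finite_subset[OF _ finite_permutations[of "{1..n}"]]) (use P in auto)
  have End: "f \<in> module_End A act ?M \<longleftrightarrow> f \<in> linear_endos ?M \<and>
      (\<forall>d\<in>D. \<forall>t\<in>?M. \<forall>j\<in>?M. (\<Sum>i | i \<in> ?M \<and> rel d i j. f (basis_vec i) t)
        = (\<Sum>l | l \<in> ?M \<and> rel d t l. f (basis_vec j) l))" for f :: "((nat \<Rightarrow> nat) \<Rightarrow> 'b) \<Rightarrow> _"
    by (rule module_End_iff[OF finite_multi_index finD carrier act])
  have cG: "carrier (group_algebra G) = (free_module (carrier G) :: ((nat \<Rightarrow> nat) \<Rightarrow> 'b) set)"
    by (simp add: group_algebra_def)
  show ?thesis
  proof (intro equalityI subsetI)
    fix f assume "f \<in> ?F ` carrier (group_algebra G)"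
    then obtain a where f: "f = ?F a" by blast
    have "(\<Sum>i | i \<in> ?M \<and> rel d i j. f (basis_vec i) t) = (\<Sum>l | l \<in> ?M \<and> rel d t l. f (basis_vec j) l)"
      if d: "d \<in> D" and t: "t \<in> ?M" and j: "j \<in> ?M" for d t j
    proof -
      have "(\<Sum>i | i \<in> ?M \<and> rel d i j. f (basis_vec i) t)
          = (\<Sum>i | i \<in> ?M \<and> rel d i j. \<Sum>\<sigma>\<in>carrier G. if compose {1..r} \<sigma> i = t then a \<sigma> else 0)"
        unfolding f using finG
        by (intro sum.cong refl)
          (auto simp: perm_representation_basis_vec sum.inter_filter[symmetric] intro!: sum.cong)
      also have "\<dots> = (\<Sum>\<sigma>\<in>carrier G. \<Sum>i | i \<in> ?M \<and> rel d i j. if compose {1..r} \<sigma> i = t then a \<sigma> else 0)"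
        by (rule sum.swap)
      \<comment> \<open>For fixed \<open>\<sigma>\<close> each side has at most one nonzero term, at
        the preimage of \<open>t\<close> on the left and at the image of \<open>j\<close> on the
        right; invariance of \<open>rel\<close> makes them equal.\<close>
      also have "\<dots> = (\<Sum>\<sigma>\<in>carrier G. \<Sum>l | l \<in> ?M \<and> rel d t l. if compose {1..r} \<sigma> j = l then a \<sigma> else 0)"
      proof (rule sum.cong[OF refl])
        fix \<sigma> assume s: "\<sigma> \<in> carrier G"
        note p = P[OF s]
        let ?u = "compose {1..r} (inv_into UNIV \<sigma>) t" and ?v = "compose {1..r} \<sigma> j"
        have u: "?u \<in> ?M" using compose_in_multi_index[OF permutes_inv[OF p] t] .
        have v: "?v \<in> ?M" using compose_in_multi_index[OF p j] .
        have iff: "compose {1..r} \<sigma> i = t \<longleftrightarrow> i = ?u" if i: "i \<in> ?M" for i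
        proof
          assume eq: "compose {1..r} \<sigma> i = t"
          show "i = ?u"
            by (rule multi_index_eqI[OF i u])
              (use permutes_inverses(2)[OF p] in \<open>simp add: eq[symmetric] compose_def\<close>)
        next
          assume eq: "i = ?u"
          show "compose {1..r} \<sigma> i = t"
            by (rule multi_index_eqI[OF compose_in_multi_index[OF p i] t])
              (use permutes_inverses(1)[OF p] in \<open>simp add: eq compose_def\<close>)
        qed
        have "compose {1..r} \<sigma> ?u = t" using iff[OF u] by simp
        then have r: "rel d ?u j \<longleftrightarrow> rel d t ?v" using inv[OF s d u j] by simp
        have "(\<Sum>i | i \<in> ?M \<and> rel d i j. if compose {1..r} \<sigma> i = t then a \<sigma> else 0)
            = (\<Sum>i | i \<in> ?M \<and> rel d i j. if i = ?u then a \<sigma> else 0)"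
          by (rule sum.cong) (use iff in auto)
        also have "\<dots> = (if rel d ?u j then a \<sigma> else 0)"
          using finite_multi_index[of n r] u by (subst sum.delta) auto
        also have "\<dots> = (\<Sum>l | l \<in> ?M \<and> rel d t l. if ?v = l then a \<sigma> else 0)"
          using finite_multi_index[of n r] v r by (subst sum.delta') auto
        finally show "(\<Sum>i | i \<in> ?M \<and> rel d i j. if compose {1..r} \<sigma> i = t then a \<sigma> else 0)
            = (\<Sum>l | l \<in> ?M \<and> rel d t l. if ?v = l then a \<sigma> else 0)" .
      qed
      also have "\<dots> = (\<Sum>l | l \<in> ?M \<and> rel d t l. \<Sum>\<sigma>\<in>carrier G. if compose {1..r} \<sigma> j = l then a \<sigma> else 0)"
        by (rule sum.swap)
      also have "\<dots> = (\<Sum>l | l \<in> ?M \<and> rel d t l. f (basis_vec j) l)"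
        unfolding f perm_representation_basis_vec[OF finG j]
        by (rule sum.cong[OF refl]) (rule sum.inter_filter[symmetric, OF finG])
      finally show ?thesis .
    qed
    then show "f \<in> module_End A act ?M"
      unfolding End using perm_representation_linear[OF P] f by auto
  next
    fix f assume "f \<in> module_End A act ?M"
    then have f: "f \<in> linear_endos ?M" and "\<And>d t j. d \<in> D \<Longrightarrow> t \<in> ?M \<Longrightarrow> j \<in> ?M \<Longrightarrow>
        (\<Sum>i | i \<in> ?M \<and> rel d i j. f (basis_vec i) t) = (\<Sum>l | l \<in> ?M \<and> rel d t l. f (basis_vec j) l)"
      unfolding End by auto
    from surj[OF this] obtain c where c: "\<And>i j. i \<in> ?M \<Longrightarrow> j \<in> ?M \<Longrightarrow>
        f (basis_vec j) i = (\<Sum>\<sigma> | \<sigma> \<in> carrier G \<and> compose {1..r} \<sigma> j = i. c \<sigma>)" by blast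
    define a where "a \<sigma> = (if \<sigma> \<in> carrier G then c \<sigma> else 0)" for \<sigma>
    have "a \<in> carrier (group_algebra G)" unfolding cG by (simp add: a_def free_module_def)
    moreover have "f = ?F a"
    proof (rule linear_endo_eqI[OF finite_multi_index f perm_representation_linear[OF P]])
      fix j i assume "j \<in> ?M" "i \<in> ?M"
      then show "f (basis_vec j) i = ?F a (basis_vec j) i"
        unfolding perm_representation_basis_vec[OF finG \<open>j \<in> ?M\<close>]
        by (simp add: c) (rule sum.cong, auto simp: a_def)
    qed
    ultimately show "f \<in> ?F ` carrier (group_algebra G)" by blast
  qed
qed

section \<open>The diagram action and diagrams given by labellings\<close>

lemma partition_action_apply:
  "partition_action n r a x t = (if t \<in> multi_index n r
     then \<Sum>d\<in>diagrams r. a d * (\<Sum>j\<in>multi_index n r. x j * relation_matrix (constant_on_blocks d) t j)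
     else 0)"
proof -
  have "(\<Sum>i | i \<in> multi_index n r \<and> constant_on_blocks d i j. basis_vec i t)
      = (if t \<in> multi_index n r then relation_matrix (constant_on_blocks d) t j else (0::'a))" for d j
  proof -
    have "(\<Sum>i | i \<in> multi_index n r \<and> constant_on_blocks d i j. basis_vec i t)
        = (\<Sum>i | i \<in> multi_index n r \<and> constant_on_blocks d i j. if t = i then 1 else (0::'a))"
      by (simp add: basis_vec_def)
    then show ?thesis
      using finite_multi_index[of n r] by (simp add: sum.delta' relation_matrix_def)
  qed
  then show ?thesis
    unfolding partition_action_def diagram_action_def lin_ext_def by simp
qed

definition fibre_diagram :: "nat \<Rightarrow> (nat \<Rightarrow> nat) \<Rightarrow> (nat \<Rightarrow> nat) \<Rightarrow> vertex set set" where
  "fibre_diagram r p q =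
     (\<lambda>u. {v \<in> {1..r} <+> {1..r}. case_sum p q v = case_sum p q u}) ` ({1..r} <+> {1..r})"

lemma fibre_diagram_in_diagrams: "fibre_diagram r p q \<in> diagrams r"
  unfolding diagrams_def fibre_diagram_def by (auto simp: partition_on_def disjoint_def)

text \<open>Two vertices share a block exactly if their labels agree. \<open>compatible\<close>
  lists the pairs top-top, top-bottom and bottom-bottom; bottom-top is covered by symmetry.\<close>

lemma constant_on_fibre_diagram:
  "constant_on_blocks (fibre_diagram r p q) i j \<longleftrightarrow> compatible {1..r} p q i j"
proof -
  let ?V = "{1..r} <+> {1..r}"
  have fibres: "(\<forall>b\<in>(\<lambda>u. {v \<in> V. h v = h u}) ` V. \<forall>u\<in>b. \<forall>w\<in>b. g u = g w) \<longleftrightarrow>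
      (\<forall>u\<in>V. \<forall>w\<in>V. h u = h w \<longrightarrow> g u = g w)" for V :: "vertex set" and h g :: "vertex \<Rightarrow> nat"
  proof (intro iffI ballI impI)
    fix u w assume *: "\<forall>b\<in>(\<lambda>u. {v \<in> V. h v = h u}) ` V. \<forall>u\<in>b. \<forall>w\<in>b. g u = g w"
      and uw: "u \<in> V" "w \<in> V" "h u = h w"
    have "{v \<in> V. h v = h u} \<in> (\<lambda>u. {v \<in> V. h v = h u}) ` V" using uw(1) by (rule imageI)
    from bspec[OF * this] have "g u = g w" if "u \<in> {v \<in> V. h v = h u}" "w \<in> {v \<in> V. h v = h u}"
      using that by blast
    then show "g u = g w" using uw(1,2) uw(3)[symmetric] by blast
  next
    fix b u w assume *: "\<forall>u\<in>V. \<forall>w\<in>V. h u = h w \<longrightarrow> g u = g w"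
      and b: "b \<in> (\<lambda>u. {v \<in> V. h v = h u}) ` V" and uw: "u \<in> b" "w \<in> b"
    from b obtain u0 where "b = {v \<in> V. h v = h u0}" by blast
    then show "g u = g w" using * uw by simp
  qed
  have "constant_on_blocks (fibre_diagram r p q) i j \<longleftrightarrow>
      (\<forall>u\<in>?V. \<forall>w\<in>?V. case_sum p q u = case_sum p q w \<longrightarrow> case_sum i j u = case_sum i j w)"
    unfolding constant_on_blocks_def fibre_diagram_def by (rule fibres)
  also have "\<dots> \<longleftrightarrow> compatible {1..r} p q i j"
  proof
    assume *: "\<forall>u\<in>?V. \<forall>w\<in>?V. case_sum p q u = case_sum p q w \<longrightarrow> case_sum i j u = case_sum i j w"
    show "compatible {1..r} p q i j"
      unfolding compatible_def
    proof (intro ballI)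
      fix a b assume ab: "a \<in> {1..r}" "b \<in> {1..r}"
      then have V: "Inl a \<in> ?V" "Inl b \<in> ?V" "Inr a \<in> ?V" "Inr b \<in> ?V" by auto
      show "(p a = p b \<longrightarrow> i a = i b) \<and> (p a = q b \<longrightarrow> i a = j b) \<and> (q a = q b \<longrightarrow> j a = j b)"
        using *[rule_format, OF V(1,2)] *[rule_format, OF V(1,4)] *[rule_format, OF V(3,4)] by simp
    qed
  next
    assume c: "compatible {1..r} p q i j"
    show "\<forall>u\<in>?V. \<forall>w\<in>?V. case_sum p q u = case_sum p q w \<longrightarrow> case_sum i j u = case_sum i j w"
    proof (intro ballI impI)
      fix u w assume uw: "u \<in> ?V" "w \<in> ?V" and eq: "case_sum p q u = case_sum p q w"
      show "case_sum i j u = case_sum i j w"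
        by (cases u; cases w; use uw eq in \<open>auto intro: compatible_top[OF c] compatible_bottom[OF c]
            compatible_top_bottom[OF c] compatible_top_bottom[OF c, symmetric]\<close>)
    qed
  qed
  finally show ?thesis .
qed

lemma fibre_diagram_in_half_diagrams:
  assumes "p (Suc r) = q (Suc r)"
  shows "fibre_diagram (Suc r) p q \<in> half_diagrams r"
proof -
  let ?b = "{v \<in> {1..Suc r} <+> {1..Suc r}. case_sum p q v = case_sum p q (Inl (Suc r))}"
  have "?b \<in> fibre_diagram (Suc r) p q" unfolding fibre_diagram_def by (rule imageI) auto
  moreover have "Inl (Suc r) \<in> ?b" "Inr (Suc r) \<in> ?b" using assms by auto
  ultimately have "\<exists>b\<in>fibre_diagram (Suc r) p q. Inl (Suc r) \<in> b \<and> Inr (Suc r) \<in> b"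
    by (intro bexI[of _ ?b] conjI)
  then show ?thesis
    using fibre_diagram_in_diagrams[of "Suc r" p q] by (simp add: half_diagrams_def)
qed

lemma constant_on_blocks_compose:
  assumes "\<sigma> permutes {1..n}" "d \<in> diagrams r"
  shows "constant_on_blocks d (compose {1..r} \<sigma> i) (compose {1..r} \<sigma> j) \<longleftrightarrow> constant_on_blocks d i j"
proof -
  have "u \<in> {1..r} <+> {1..r}" if "b \<in> d" "u \<in> b" for u b
    using assms(2) that by (auto simp: diagrams_def partition_on_def)
  then have "case_sum (compose {1..r} \<sigma> i) (compose {1..r} \<sigma> j) u = \<sigma> (case_sum i j u)"
    if "b \<in> d" "u \<in> b" for u b
    using that by (fastforce simp: compose_def)
  then show ?thesis
    unfolding constant_on_blocks_def using permutes_inj[OF assms(1)] by (simp add: inj_eq)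
qed

lemma compose_eq_iff:
  assumes "i \<in> multi_index n r"
  shows "compose {1..r} \<sigma> j = i \<longleftrightarrow> (\<forall>k\<in>{1..r}. \<sigma> (j k) = i k)"
  using assms by (auto simp: multi_index_def compose_def fun_eq_iff PiE_def extensional_def)

text \<open>The case without pinned positions: the permutations that extend the index graph of
  \<open>i\<close> and \<open>j\<close> are those that carry \<open>j\<close> to
  \<open>i\<close>.\<close>

theorem image_sym_group_eq_module_End:
  assumes "r > 0"
  shows "perm_representation (sym_group n) n r
           ` carrier (group_algebra (sym_group n) :: ((nat \<Rightarrow> nat) \<Rightarrow> 'b::{comm_ring,comm_monoid_mult}) ring)
         = module_End (partition_algebra (\<delta> :: 'b) r) (partition_action n r) (multi_index n r)"
proof (rule image_perm_representation_eq_module_End[where D = "diagrams r" and rel = constant_on_blocks])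
  show "\<sigma> permutes {1..n}" if "\<sigma> \<in> carrier (sym_group n)" for \<sigma>
    using that by (simp add: sym_group_def)
  then show "constant_on_blocks d (compose {1..r} \<sigma> i) (compose {1..r} \<sigma> j) \<longleftrightarrow> constant_on_blocks d i j"
    if "\<sigma> \<in> carrier (sym_group n)" "d \<in> diagrams r" for \<sigma> d i j
    using constant_on_blocks_compose that by blast
  show "carrier (partition_algebra \<delta> r) = free_module (diagrams r)"
    by (simp add: partition_algebra_def)
  let ?M = "multi_index n r"
  fix f :: "((nat \<Rightarrow> nat) \<Rightarrow> 'b) \<Rightarrow> (nat \<Rightarrow> nat) \<Rightarrow> 'b"
  assume comm: "\<And>d t j. d \<in> diagrams r \<Longrightarrow> t \<in> ?M \<Longrightarrow> j \<in> ?M \<Longrightarrow>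
      (\<Sum>i | i \<in> ?M \<and> constant_on_blocks d i j. f (basis_vec i) t)
      = (\<Sum>l | l \<in> ?M \<and> constant_on_blocks d t l. f (basis_vec j) l)"
  have M: "pinned_index {1..r} {} n = ?M" by (simp add: pinned_index_def multi_index_def)
  interpret invariant_kernel "{1..r}" "{}" n "\<lambda>i j. f (basis_vec j) i"
  proof
    fix p q :: "nat \<Rightarrow> nat" and t j
    assume "t \<in> pinned_index {1..r} {} n" "j \<in> pinned_index {1..r} {} n"
    then show "(\<Sum>i | i \<in> pinned_index {1..r} {} n \<and> compatible {1..r} p q i j. f (basis_vec i) t)
        = (\<Sum>l | l \<in> pinned_index {1..r} {} n \<and> compatible {1..r} p q t l. f (basis_vec j) l)"
      using comm[OF fibre_diagram_in_diagrams, of t j p q] unfolding M constant_on_fibre_diagram by blast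
  qed auto
  have "{1..r} \<noteq> {}" using assms by simp
  from kernel_eq_sum_extensions[OF refl this] obtain c where
    c: "\<And>i j. i \<in> ?M \<Longrightarrow> j \<in> ?M \<Longrightarrow> f (basis_vec j) i = (\<Sum>\<sigma>\<in>extensions n (index_graph {1..r} i j). c \<sigma>)"
    unfolding M by blast
  have "extensions n (index_graph {1..r} i j) = {\<sigma>. \<sigma> \<in> carrier (sym_group n) \<and> compose {1..r} \<sigma> j = i}"
    if "i \<in> ?M" for i j
    unfolding compose_eq_iff[OF that] by (auto simp: extensions_def index_graph_def sym_group_def)
  then show "\<exists>c. \<forall>i\<in>?M. \<forall>j\<in>?M. f (basis_vec j) i
      = (\<Sum>\<sigma> | \<sigma> \<in> carrier (sym_group n) \<and> compose {1..r} \<sigma> j = i. c \<sigma>)"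
    using c by (intro exI[of _ c]) simp
qed (simp_all add: finite_diagrams partition_action_apply)

section \<open>The half partition algebra\<close>

context
  fixes n r :: nat
  assumes n: "n > 0"
begin

abbreviation append_last :: "(nat \<Rightarrow> nat) \<Rightarrow> nat \<Rightarrow> nat" where
  "append_last i \<equiv> i(Suc r := n)"

lemma append_last_in: "i \<in> multi_index n r \<Longrightarrow> append_last i \<in> multi_index n (Suc r)"
  using n by (auto simp: multi_index_def PiE_def extensional_def Pi_def)

lemma restrict_append_last:
  assumes "i \<in> multi_index n r" shows "restrict (append_last i) {1..r} = i"
  using assms by (auto simp: multi_index_def fun_eq_iff PiE_def extensional_def)

lemma inj_append_last: "inj_on append_last (multi_index n r)"
  by (rule inj_on_inverseI[of _ "\<lambda>i. restrict i {1..r}"]) (rule restrict_append_last)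

lemma image_append_last: "append_last ` multi_index n r = {i \<in> multi_index n (Suc r). i (Suc r) = n}"
proof (intro equalityI subsetI)
  fix i assume i: "i \<in> {i \<in> multi_index n (Suc r). i (Suc r) = n}"
  then have "restrict i {1..r} \<in> multi_index n r" by (auto simp: multi_index_def)
  moreover have "i = append_last (restrict i {1..r})"
    using i by (auto simp: multi_index_def fun_eq_iff PiE_def extensional_def)
  ultimately show "i \<in> append_last ` multi_index n r" by blast
qed (use append_last_in in auto)

lemma tensor_last_append_last:
  assumes "i \<in> multi_index n r"
  shows "tensor_last n r x (append_last i) = x i"
proof -
  have "tensor_last n r x (append_last i) = (\<Sum>j\<in>multi_index n r. x j * basis_vec j i)"
    unfolding tensor_last_def lin_ext_def
    by (rule sum.cong) (use inj_on_eq_iff[OF inj_append_last] assms in \<open>auto simp: basis_vec_def\<close>)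
  then show ?thesis using sum_basis_vec(2)[OF finite_multi_index assms] by simp
qed

lemma tensor_last_eq_0: "t \<notin> append_last ` multi_index n r \<Longrightarrow> tensor_last n r x t = 0"
  unfolding tensor_last_def lin_ext_def by (intro sum.neutral) (auto simp: basis_vec_def)

text \<open>This makes \<open>inv_into\<close> in \<open>half_partition_action\<close> an actual
  inverse on the image.\<close>

lemma inj_tensor_last: "inj_on (tensor_last n r) (free_module (multi_index n r))"
proof (rule inj_onI)
  fix x y :: "(nat \<Rightarrow> nat) \<Rightarrow> 'b::{comm_ring,comm_monoid_mult}"
  assume xy: "x \<in> free_module (multi_index n r)" "y \<in> free_module (multi_index n r)"
    and eq: "tensor_last n r x = tensor_last n r y"
  show "x = y"
  proof
    fix i show "x i = y i"
      using xy tensor_last_append_last[of i x] tensor_last_append_last[of i y] eq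
      by (cases "i \<in> multi_index n r") (auto simp: free_module_def)
  qed
qed

text \<open>\<open>y\<close> is exhibited as the preimage under \<open>tensor_last\<close>. That the
  image stays in the span of the \<open>append_last i\<close> is where half diagrams enter: the
  block joining \<open>Suc r\<close> to its primed copy carries the last value \<open>n\<close>
  upwards.\<close>

lemma half_partition_action_apply:
  assumes a: "a \<in> free_module (half_diagrams r)" and x: "x \<in> free_module (multi_index n r)"
  shows "half_partition_action n r a x t = (if t \<in> multi_index n r
     then \<Sum>d\<in>half_diagrams r. a d * (\<Sum>j\<in>multi_index n r. x j *
        relation_matrix (\<lambda>i j. constant_on_blocks d (append_last i) (append_last j)) t j)
     else 0)"
proof -
  let ?M = "multi_index n r"
  define y where "y t = (if t \<in> ?M
     then \<Sum>d\<in>half_diagrams r. a d * (\<Sum>j\<in>?M. x j *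
        relation_matrix (\<lambda>i j. constant_on_blocks d (append_last i) (append_last j)) t j)
     else 0)" for t
  have y: "y \<in> free_module ?M" by (simp add: y_def free_module_def)
  have pa: "partition_action n (Suc r) a (tensor_last n r x) t = (if t \<in> multi_index n (Suc r)
      then \<Sum>d\<in>half_diagrams r. a d * (\<Sum>j\<in>?M. x j * relation_matrix (constant_on_blocks d) t (append_last j))
      else 0)" for t
  proof -
    have "(\<Sum>j\<in>multi_index n (Suc r). tensor_last n r x j * relation_matrix (constant_on_blocks d) t j)
        = (\<Sum>j\<in>append_last ` ?M. tensor_last n r x j * relation_matrix (constant_on_blocks d) t j)" for d
      by (rule sum.mono_neutral_right)
        (use append_last_in tensor_last_eq_0[of _ x] finite_multi_index in auto)
    also have "\<dots> d = (\<Sum>j\<in>?M. x j * relation_matrix (constant_on_blocks d) t (append_last j))" for d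
      unfolding sum.reindex[OF inj_append_last] by (rule sum.cong) (simp_all add: tensor_last_append_last)
    finally have in_sum: "(\<Sum>j\<in>multi_index n (Suc r). tensor_last n r x j * relation_matrix (constant_on_blocks d) t j)
        = (\<Sum>j\<in>?M. x j * relation_matrix (constant_on_blocks d) t (append_last j))" for d .
    have "(\<Sum>d\<in>diagrams (Suc r). a d * g d) = (\<Sum>d\<in>half_diagrams r. a d * g d)" for g
      by (rule sum.mono_neutral_right)
        (use a finite_diagrams in \<open>auto simp: half_diagrams_def free_module_def\<close>)
    then show ?thesis unfolding partition_action_apply in_sum by simp
  qed
  have "tensor_last n r y = partition_action n (Suc r) a (tensor_last n r x)"
  proof
    fix t
    show "tensor_last n r y t = partition_action n (Suc r) a (tensor_last n r x) t"
    proof (cases "t \<in> append_last ` ?M")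
      case True
      then obtain i where i: "i \<in> ?M" "t = append_last i" by blast
      then show ?thesis
        unfolding i(2) tensor_last_append_last[OF i(1)] pa
        using append_last_in[OF i(1)] by (simp add: y_def relation_matrix_def)
    next
      case False
      have "\<not> constant_on_blocks d t (append_last j)"
        if t: "t \<in> multi_index n (Suc r)" and d: "d \<in> half_diagrams r" for d j
      proof
        assume c: "constant_on_blocks d t (append_last j)"
        obtain b where b: "b \<in> d" "Inl (Suc r) \<in> b" "Inr (Suc r) \<in> b"
          using d by (auto simp: half_diagrams_def)
        have "case_sum t (append_last j) (Inl (Suc r)) = case_sum t (append_last j) (Inr (Suc r))"
          using c b unfolding constant_on_blocks_def by blast
        then have "t (Suc r) = n" by simp
        then show False using False t unfolding image_append_last by simp
      qed
      then have "partition_action n (Suc r) a (tensor_last n r x) t = 0"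
        unfolding pa by (auto simp: relation_matrix_def intro!: sum.neutral)
      then show ?thesis using tensor_last_eq_0[OF False] by simp
    qed
  qed
  then have "half_partition_action n r a x = y"
    unfolding half_partition_action_def by (metis inv_into_f_f[OF inj_tensor_last y])
  then show ?thesis by (simp add: y_def)
qed

text \<open>Indices of length \<open>r\<close> are extended by the value \<open>n\<close>, pinned at
  \<open>Suc r\<close>, and restricting back transports the matrix of \<open>f\<close>. The extra
  pair \<open>(n, n)\<close> in the graphs says that the permutation fixes \<open>n\<close>.\<close>

theorem image_sym_group_fixing_last_eq_module_End:
  "perm_representation (sym_group_fixing_last n) n r
     ` carrier (group_algebra (sym_group_fixing_last n) :: ((nat \<Rightarrow> nat) \<Rightarrow> 'b::{comm_ring,comm_monoid_mult}) ring)
   = module_End (half_partition_algebra (\<delta> :: 'b) r) (half_partition_action n r) (multi_index n r)"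
proof (rule image_perm_representation_eq_module_End[where D = "half_diagrams r"
      and rel = "\<lambda>d i j. constant_on_blocks d (append_last i) (append_last j)"])
  let ?G = "sym_group_fixing_last n"
  show P: "\<sigma> permutes {1..n}" if "\<sigma> \<in> carrier ?G" for \<sigma>
    using that by (simp add: sym_group_fixing_last_def sym_group_def)
  show "finite (half_diagrams r)"
    by (rule finite_subset[OF _ finite_diagrams[of "Suc r"]]) (auto simp: half_diagrams_def)
  show "carrier (half_partition_algebra \<delta> r) = free_module (half_diagrams r)"
    by (simp add: half_partition_algebra_def)
  show "constant_on_blocks d (append_last (compose {1..r} \<sigma> i)) (append_last (compose {1..r} \<sigma> j))
      \<longleftrightarrow> constant_on_blocks d (append_last i) (append_last j)"
    if s: "\<sigma> \<in> carrier ?G" and d: "d \<in> half_diagrams r"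
      and ij: "i \<in> multi_index n r" "j \<in> multi_index n r" for \<sigma> d i j
  proof -
    have "\<sigma> n = n" using s by (simp add: sym_group_fixing_last_def)
    then have "append_last (compose {1..r} \<sigma> i) = compose {1..Suc r} \<sigma> (append_last i)" for i
      by (auto simp: compose_def fun_eq_iff restrict_def)
    then show ?thesis
      using constant_on_blocks_compose[OF P[OF s], of d "Suc r"] d by (simp add: half_diagrams_def)
  qed
  let ?M = "multi_index n r"
  fix f :: "((nat \<Rightarrow> nat) \<Rightarrow> 'b) \<Rightarrow> (nat \<Rightarrow> nat) \<Rightarrow> 'b"
  assume comm: "\<And>d t j. d \<in> half_diagrams r \<Longrightarrow> t \<in> ?M \<Longrightarrow> j \<in> ?M \<Longrightarrow>
      (\<Sum>i | i \<in> ?M \<and> constant_on_blocks d (append_last i) (append_last j). f (basis_vec i) t)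
      = (\<Sum>l | l \<in> ?M \<and> constant_on_blocks d (append_last t) (append_last l). f (basis_vec j) l)"
  have M: "pinned_index {1..Suc r} {Suc r} n = append_last ` ?M"
    unfolding image_append_last by (auto simp: pinned_index_def multi_index_def)
  let ?res = "\<lambda>i. restrict i {1..r}"
  have reindex: "(\<Sum>i | i \<in> append_last ` ?M \<and> Q i. g (?res i)) = (\<Sum>i | i \<in> ?M \<and> Q (append_last i). g i)"
    for Q and g :: "_ \<Rightarrow> 'b"
  proof -
    have "{i. i \<in> append_last ` ?M \<and> Q i} = append_last ` {i. i \<in> ?M \<and> Q (append_last i)}" by blast
    moreover have "inj_on append_last {i. i \<in> ?M \<and> Q (append_last i)}"
      by (rule inj_on_subset[OF inj_append_last]) auto
    ultimately show ?thesis
      using restrict_append_last by (simp add: sum.reindex)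
  qed
  interpret invariant_kernel "{1..Suc r}" "{Suc r}" n "\<lambda>i j. f (basis_vec (?res j)) (?res i)"
  proof
    fix p q :: "nat \<Rightarrow> nat" and t j
    assume pq: "\<And>z. z \<in> {Suc r} \<Longrightarrow> p z = q z"
      and tj: "t \<in> pinned_index {1..Suc r} {Suc r} n" "j \<in> pinned_index {1..Suc r} {Suc r} n"
    obtain t' j' where t': "t' \<in> ?M" "t = append_last t'" and j': "j' \<in> ?M" "j = append_last j'"
      using tj unfolding M by blast
    have "fibre_diagram (Suc r) p q \<in> half_diagrams r"
      using pq by (intro fibre_diagram_in_half_diagrams) simp
    from comm[OF this t'(1) j'(1)]
    show "(\<Sum>i | i \<in> pinned_index {1..Suc r} {Suc r} n \<and> compatible {1..Suc r} p q i j.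
          f (basis_vec (?res i)) (?res t))
        = (\<Sum>l | l \<in> pinned_index {1..Suc r} {Suc r} n \<and> compatible {1..Suc r} p q t l.
          f (basis_vec (?res j)) (?res l))"
      unfolding M reindex[of "\<lambda>i. f (basis_vec i) (?res t)"]
        reindex[of "\<lambda>l. f (basis_vec (?res j)) l"]
      unfolding t'(2) j'(2) restrict_append_last[OF t'(1)] restrict_append_last[OF j'(1)]
        constant_on_fibre_diagram .
  qed auto
  from pinned_kernel_eq_sum_extensions[OF refl n] obtain c where
    c: "\<And>i j. i \<in> append_last ` ?M \<Longrightarrow> j \<in> append_last ` ?M \<Longrightarrow>
      f (basis_vec (?res j)) (?res i) = (\<Sum>\<sigma>\<in>extensions n (index_graph {1..Suc r} i j). c \<sigma>)"
    unfolding M by blast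
  have "f (basis_vec j) i = (\<Sum>\<sigma> | \<sigma> \<in> carrier ?G \<and> compose {1..r} \<sigma> j = i. c \<sigma>)"
    if ij: "i \<in> ?M" "j \<in> ?M" for i j
  proof -
    have "extensions n (index_graph {1..Suc r} (append_last i) (append_last j))
        = {\<sigma>. \<sigma> \<in> carrier ?G \<and> compose {1..r} \<sigma> j = i}"
      unfolding compose_eq_iff[OF ij(1)]
      by (auto simp: extensions_def index_graph_def sym_group_fixing_last_def sym_group_def
          atLeastAtMostSuc_conv)
    then show ?thesis
      using c[of "append_last i" "append_last j"] ij restrict_append_last by simp
  qed
  then show "\<exists>c. \<forall>i\<in>?M. \<forall>j\<in>?M. f (basis_vec j) i
      = (\<Sum>\<sigma> | \<sigma> \<in> carrier ?G \<and> compose {1..r} \<sigma> j = i. c \<sigma>)"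
    by blast
qed (simp add: half_partition_action_apply)

end

theorem corollary6p5:
  fixes n r :: nat
  assumes "n > 0" and "r > 0"
  shows "perm_representation (sym_group n) n r
           ` carrier (group_algebra (sym_group n) :: ((nat \<Rightarrow> nat) \<Rightarrow> 'b::{comm_ring,comm_monoid_mult}) ring)
         = module_End (partition_algebra (nat_in_ring n :: 'b) r) (partition_action n r) (multi_index n r)
       \<and> perm_representation (sym_group_fixing_last n) n r
           ` carrier (group_algebra (sym_group_fixing_last n) :: ((nat \<Rightarrow> nat) \<Rightarrow> 'b) ring)
         = module_End (half_partition_algebra (nat_in_ring n :: 'b) r) (half_partition_action n r) (multi_index n r)"
  using image_sym_group_eq_module_End[OF assms(2)] image_sym_group_fixing_last_eq_module_End[OF assms(1)] by blast

end
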